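(* Let $F:P_0\mathbb{R}^n\to(0,\infty)$ be a positive $\mathbb P_0$-integrable function. Then the functional $$\Phi_F:\mathcal H\to(-\infty,+\infty],\qquad \Phi_F(h)=\ln\left(\int_{P_0\mathbb{R}^n}F(\gamma+h)\,d\mathbb P_0(\gamma)\right)+\frac14\|h\|_{\mathcal H}^2$$ is convex, i.e. $\Phi_F(\lambda_1h_1+\lambda_2h_2)\le\lambda_1\Phi_F(h_1)+\lambda_2\Phi_F(h_2)$ for all $h_1,h_2\in\mathcal H$ and $\lambda_1,\lambda_2\in(0,1)$ with $\lambda_1+\lambda_2=1$.
   Context: $P_0\mathbb{R}^n=\{\gamma\in C^0([0,\infty),\mathbb{R}^n):\gamma(0)=0\}$ with the Borel $\sigma$-algebra of the compact-open topology. $\mathbb P_0$ is the Wiener measure on $P_0\mathbb R^n$ normalized so that the coordinate process is a Brownian motion with generator $\Delta_{\mathbb R^n}$ (not $\frac12\Delta$), i.e. covariation $[W^a,W^b]_t=2t\delta_{ab}$; equivalently, for $0<t_1<\dots<t_k$, the law of $(\gamma_{t_1},\dots,\gamma_{t_k})$ is $\rho_{t_1}(0,dy_1)\rho_{t_2-t_1}(y_1,dy_2)\cdots\rho_{t_k-t_{k-1}}(y_{k-1},dy_k)$, where $\rho_t(x,dy)=(4\pi t)^{-n/2}e^{-|x-y|^2/4t}dy$. The Cameron–Martin space is $\mathcal H=\{h\in P_0\mathbb R^n:\ h \text{ absolutely continuous},\ \|h\|_{\mathcal H}^2=\int_0^\infty|\dot h_t|^2dt<\infty\}$. *)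

theory Defs
  imports "HOL-Analysis.Analysis" "HOL-Probability.Probability"
begin

text \<open>Path space P_0 R^n: continuous paths on [0,oo) starting at 0.
  Paths are HOL functions real => real^'n, normalised to be 0 on the negative half-line.\<close>
definition P0 :: "(real \<Rightarrow> real^'n) set" where
  "P0 = {\<gamma>. continuous_on {0..} \<gamma> \<and> \<gamma> 0 = 0 \<and> (\<forall>t<0. \<gamma> t = 0)}"

definition compact_open_P0 :: "(real \<Rightarrow> real^'n) topology" where
  "compact_open_P0 = topology_generated_by
     {{\<gamma> \<in> P0. \<gamma> ` K \<subseteq> U} | K U. compact K \<and> K \<subseteq> {0..} \<and> open U}"

definition borel_P0 :: "(real \<Rightarrow> real^'n) measure" where
  "borel_P0 = sigma P0 {S. openin compact_open_P0 S}"

text \<open>Heat kernel of the generator Delta (not Delta/2).\<close>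
definition heat_kernel :: "real \<Rightarrow> real^'n \<Rightarrow> real^'n \<Rightarrow> real" where
  "heat_kernel t x y = (4 * pi * t) powr (- real CARD('n) / 2) * exp (- (norm (x - y))\<^sup>2 / (4 * t))"

definition is_wiener_measure :: "(real \<Rightarrow> real^'n) measure \<Rightarrow> bool" where
  "is_wiener_measure P \<longleftrightarrow>
     prob_space P \<and> space P = P0 \<and> sets P = sets borel_P0 \<and>
     (\<forall>(k::nat) (t::nat \<Rightarrow> real).
        (k > 0 \<and> 0 < t 0 \<and> (\<forall>i. Suc i < k \<longrightarrow> t i < t (Suc i))) \<longrightarrow>
        distr P (PiM {..<k} (\<lambda>_. lborel)) (\<lambda>\<gamma>. \<lambda>i\<in>{..<k}. \<gamma> (t i))
        = density (PiM {..<k} (\<lambda>_. (lborel :: (real^'n) measure)))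
            (\<lambda>y. \<Prod>i<k. ennreal (heat_kernel
                     (if i = 0 then t 0 else t i - t (i - 1))
                     (if i = 0 then 0 else y (i - 1)) (y i))))"

definition abs_cont_on :: "real set \<Rightarrow> (real \<Rightarrow> 'a::real_normed_vector) \<Rightarrow> bool" where
  "abs_cont_on S h \<longleftrightarrow>
     (\<forall>\<epsilon>>0. \<exists>\<delta>>0. \<forall>(k::nat) (a::nat \<Rightarrow> real) (b::nat \<Rightarrow> real).
        (\<forall>i<k. a i \<in> S \<and> b i \<in> S \<and> {a i..b i} \<subseteq> S \<and> a i \<le> b i) \<and>
        (\<forall>i. Suc i < k \<longrightarrow> b i \<le> a (Suc i)) \<and>
        (\<Sum>i<k. b i - a i) < \<delta>
        \<longrightarrow> (\<Sum>i<k. norm (h (b i) - h (a i))) < \<epsilon>)"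

definition CM_energy :: "(real \<Rightarrow> real^'n) \<Rightarrow> ennreal" where
  "CM_energy h = (\<integral>\<^sup>+ t\<in>{0..}. ennreal ((norm (vector_derivative h (at t within {0..})))\<^sup>2) \<partial>lebesgue)"

definition CM :: "(real \<Rightarrow> real^'n) set" where
  "CM = {h \<in> P0. abs_cont_on {0..} h \<and> CM_energy h < \<infinity>}"

definition CM_norm_sq :: "(real \<Rightarrow> real^'n) \<Rightarrow> real" where
  "CM_norm_sq h = enn2real (CM_energy h)"

definition Phi :: "(real \<Rightarrow> real^'n) measure \<Rightarrow> ((real \<Rightarrow> real^'n) \<Rightarrow> real)
                   \<Rightarrow> (real \<Rightarrow> real^'n) \<Rightarrow> ereal" where
  "Phi P F h = (let I = (\<integral>\<^sup>+ \<gamma>. ennreal (F (\<lambda>s. \<gamma> s + h s)) \<partial>P) in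
      if I = \<infinity> then \<infinity> else ereal (ln (enn2real I) + CM_norm_sq h / 4))"

end

theory Submission
  imports Defs
begin

text \<open>
  Let \<open>\<mu>\<^sub>h\<close> be the law of \<open>\<gamma> + h\<close> under Wiener measure. The claim is
  \<open>\<integral>F d\<mu>\<^sub>h \<le> C (\<integral>F d\<mu>\<^sub>1)\<^bsup>l1\<^esup> (\<integral>F d\<mu>\<^sub>2)\<^bsup>l2\<^esup>\<close> with \<open>h = l1 h1 + l2 h2\<close>, \<open>\<mu>\<^sub>i\<close> the law of \<open>\<gamma> + hi\<close> and
  \<open>C = exp (l1 l2 \<parallel>h1 - h2\<parallel>\<^sup>2 / 4)\<close>, because \<open>l1 \<parallel>h1\<parallel>\<^sup>2 + l2 \<parallel>h2\<parallel>\<^sup>2 - \<parallel>h\<parallel>\<^sup>2 = l1 l2 \<parallel>h1 - h2\<parallel>\<^sup>2\<close>.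
  By Young's inequality it suffices to have, for every real \<open>\<theta>\<close>, the inequality of measures
  \<open>\<mu>\<^sub>h \<le> C (l1 exp (l2 \<theta>) \<mu>\<^sub>1 + l2 exp (- l1 \<theta>) \<mu>\<^sub>2)\<close>. No stochastic integral is needed: on
  the algebra of cylinder sets over dyadic times the inequality holds pointwise for the Gaussian
  densities, since the discrete energy of \<open>h1 - h2\<close> along a grid is at most its Cameron-Martin energy,
  and it passes to the generated sigma-algebra, which is the Borel sigma-algebra of path space.

  The energy is defined through the pointwise derivative, so the two facts about it rest on the
  Lebesgue theorem that an absolutely continuous function is the integral of its almost everywhere
  derivative. Here the density is a Radon-Nikodym derivative of the Stieltjes measures of the total
  variation \<open>V\<close> and of \<open>V - f\<close>.
\<close>

section \<open>Absolutely continuous functions\<close>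

text \<open>The interval families of \<open>abs_cont_on\<close>, specialised to the half-line.
  Neighbours may touch and intervals may be degenerate; later chains use both.\<close>

definition interval_chain :: "nat \<Rightarrow> (nat \<Rightarrow> real) \<Rightarrow> (nat \<Rightarrow> real) \<Rightarrow> bool" where
  "interval_chain k a b \<longleftrightarrow>
     (\<forall>i<k. 0 \<le> a i \<and> a i \<le> b i) \<and> (\<forall>i. Suc i < k \<longrightarrow> b i \<le> a (Suc i))"

lemma abs_cont_on_atLeast_iff:
  fixes h :: "real \<Rightarrow> 'a::real_normed_vector"
  shows "abs_cont_on {0..} h \<longleftrightarrow>
     (\<forall>\<epsilon>>0. \<exists>\<delta>>0. \<forall>k a b. interval_chain k a b \<and> (\<Sum>i<k. b i - a i) < \<delta>
        \<longrightarrow> (\<Sum>i<k. norm (h (b i) - h (a i))) < \<epsilon>)"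
proof -
  have "(a \<in> {0..} \<and> b \<in> {0..} \<and> {a..b} \<subseteq> {0..} \<and> a \<le> b) \<longleftrightarrow> (0 \<le> a \<and> a \<le> b)" for a b :: real
    by auto
  then show ?thesis unfolding abs_cont_on_def interval_chain_def by simp
qed

lemma abs_cont_on_atLeastE:
  fixes h :: "real \<Rightarrow> 'a::real_normed_vector"
  assumes "abs_cont_on {0..} h" "0 < \<epsilon>"
  obtains \<delta> where "0 < \<delta>"
    "\<And>k a b. interval_chain k a b \<Longrightarrow> (\<Sum>i<k. b i - a i) < \<delta> \<Longrightarrow>
       (\<Sum>i<k. norm (h (b i) - h (a i))) < \<epsilon>"
proof -
  obtain \<delta> where "0 < \<delta>" and *: "\<forall>k a b. interval_chain k a b \<and> (\<Sum>i<k. b i - a i) < \<delta>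
        \<longrightarrow> (\<Sum>i<k. norm (h (b i) - h (a i))) < \<epsilon>"
    using assms unfolding abs_cont_on_atLeast_iff by blast
  show thesis by (rule that[OF \<open>0 < \<delta>\<close>]) (use * in blast)
qed

lemma abs_cont_on_atLeast_component:
  fixes h :: "real \<Rightarrow> real^'n"
  assumes "abs_cont_on {0..} h"
  shows "abs_cont_on {0..} (\<lambda>t. h t $ i)"
  unfolding abs_cont_on_atLeast_iff
proof (intro allI impI)
  fix \<epsilon> :: real assume e: "0 < \<epsilon>"
  obtain \<delta> where \<delta>: "0 < \<delta>"
    "\<And>k a b. interval_chain k a b \<Longrightarrow> (\<Sum>i<k. b i - a i) < \<delta> \<Longrightarrow>
       (\<Sum>i<k. norm (h (b i) - h (a i))) < \<epsilon>"
    using abs_cont_on_atLeastE[OF assms e] by blast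
  show "\<exists>\<delta>>0. \<forall>k a b. interval_chain k a b \<and>
        (\<Sum>i<k. b i - a i) < \<delta> \<longrightarrow> (\<Sum>j<k. norm (h (b j) $ i - h (a j) $ i)) < \<epsilon>"
  proof (intro exI[of _ \<delta>] conjI allI impI \<delta>(1))
    fix k :: nat and a b :: "nat \<Rightarrow> real"
    assume "interval_chain k a b \<and> (\<Sum>i<k. b i - a i) < \<delta>"
    then have "(\<Sum>j<k. norm (h (b j) - h (a j))) < \<epsilon>"
      by (intro \<delta>(2)) auto
    moreover have "(\<Sum>j<k. norm (h (b j) $ i - h (a j) $ i)) \<le> (\<Sum>j<k. norm (h (b j) - h (a j)))"
      proof (intro sum_mono)
      fix j
      show "norm (h (b j) $ i - h (a j) $ i) \<le> norm (h (b j) - h (a j))"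
        using component_le_norm_cart[of "h (b j) - h (a j)" i] by simp
    qed
    ultimately show "(\<Sum>j<k. norm (h (b j) $ i - h (a j) $ i)) < \<epsilon>" by linarith
  qed
qed

lemma abs_cont_on_atLeast_diff:
  fixes f g :: "real \<Rightarrow> 'a::real_normed_vector"
  assumes "abs_cont_on {0..} f" "abs_cont_on {0..} g"
  shows "abs_cont_on {0..} (\<lambda>t. f t - g t)"
  unfolding abs_cont_on_atLeast_iff
proof (intro allI impI)
  fix \<epsilon> :: real assume "0 < \<epsilon>"
  then have e: "0 < \<epsilon> / 2" by simp
  obtain \<delta>1 where \<delta>1: "0 < \<delta>1"
    "\<And>k a b. interval_chain k a b \<Longrightarrow> (\<Sum>i<k. b i - a i) < \<delta>1 \<Longrightarrow>
       (\<Sum>i<k. norm (f (b i) - f (a i))) < \<epsilon> / 2"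
    using abs_cont_on_atLeastE[OF assms(1) e] by blast
  obtain \<delta>2 where \<delta>2: "0 < \<delta>2"
    "\<And>k a b. interval_chain k a b \<Longrightarrow> (\<Sum>i<k. b i - a i) < \<delta>2 \<Longrightarrow>
       (\<Sum>i<k. norm (g (b i) - g (a i))) < \<epsilon> / 2"
    using abs_cont_on_atLeastE[OF assms(2) e] by blast
  show "\<exists>\<delta>>0. \<forall>k a b. interval_chain k a b \<and>
        (\<Sum>i<k. b i - a i) < \<delta> \<longrightarrow> (\<Sum>j<k. norm ((f (b j) - g (b j)) - (f (a j) - g (a j)))) < \<epsilon>"
  proof (intro exI[of _ "min \<delta>1 \<delta>2"] conjI allI impI)
    show "0 < min \<delta>1 \<delta>2" using \<delta>1 \<delta>2 by simp
    fix k :: nat and a b :: "nat \<Rightarrow> real"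
    assume *: "interval_chain k a b \<and> (\<Sum>i<k. b i - a i) < min \<delta>1 \<delta>2"
    have "(\<Sum>j<k. norm (f (b j) - f (a j))) < \<epsilon> / 2"
      using * by (intro \<delta>1(2)) auto
    moreover have "(\<Sum>j<k. norm (g (b j) - g (a j))) < \<epsilon> / 2"
      using * by (intro \<delta>2(2)) auto
    moreover have "(\<Sum>j<k. norm ((f (b j) - g (b j)) - (f (a j) - g (a j))))
        \<le> (\<Sum>j<k. norm (f (b j) - f (a j)) + norm (g (b j) - g (a j)))"
      proof (intro sum_mono)
      fix j
      have "(f (b j) - g (b j)) - (f (a j) - g (a j)) = (f (b j) - f (a j)) - (g (b j) - g (a j))" by simp
      then show "norm ((f (b j) - g (b j)) - (f (a j) - g (a j))) \<le> norm (f (b j) - f (a j)) + norm (g (b j) - g (a j))"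
        by (simp only: norm_triangle_ineq4)
    qed
    ultimately show "(\<Sum>j<k. norm ((f (b j) - g (b j)) - (f (a j) - g (a j)))) < \<epsilon>"
      by (simp add: sum.distrib)
  qed
qed

section \<open>Total variation\<close>

text \<open>Truncating one grid to the window [a, b] samples \<open>f\<close> on [a, b] only, and degenerate cells
  contribute nothing; this lets partitions of different windows be concatenated without sorting.\<close>
definition clip :: "real \<Rightarrow> real \<Rightarrow> real \<Rightarrow> real" where
  "clip a b x = max a (min b x)"

definition grid_var :: "(real \<Rightarrow> real) \<Rightarrow> nat \<times> (nat \<Rightarrow> real) \<Rightarrow> real \<Rightarrow> real \<Rightarrow> real" where
  "grid_var f g a b = (\<Sum>j<fst g. \<bar>f (clip a b (snd g (Suc j))) - f (clip a b (snd g j))\<bar>)"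

definition grids :: "(nat \<times> (nat \<Rightarrow> real)) set" where
  "grids = {g. mono (snd g)}"

definition total_var :: "(real \<Rightarrow> real) \<Rightarrow> real \<Rightarrow> real" where
  "total_var f x = (SUP g\<in>grids. grid_var f g 0 x)"

lemma clip_mono: "x \<le> y \<Longrightarrow> clip a b x \<le> clip a b y"
  by (auto simp: clip_def)

text \<open>A cell straddling \<open>a\<close> is cut there: sampling up to \<open>b\<close>
  satisfies \<open>f (clip 0 b t) = f (clip 0 a t) + f (clip a b t) - f a\<close>, and the triangle
  inequality is applied to the increments.\<close>

lemma grid_var_add:
  assumes "0 \<le> a" "a \<le> b"
  shows "grid_var f g 0 b \<le> grid_var f g 0 a + grid_var f g a b"
proof -
  have "f (clip 0 b t) = f (clip 0 a t) + f (clip a b t) - f a" for t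
    using assms by (cases "t \<le> a") (auto simp: clip_def max_def min_def)
  then have "\<bar>f (clip 0 b s) - f (clip 0 b t)\<bar>
      \<le> \<bar>f (clip 0 a s) - f (clip 0 a t)\<bar> + \<bar>f (clip a b s) - f (clip a b t)\<bar>" for s t
    by (smt (verit))
  then show ?thesis
    unfolding grid_var_def sum.distrib[symmetric] by (intro sum_mono) auto
qed

text \<open>Flattens a doubly indexed family: \<open>abs_cont_on\<close> takes a single sequence of
  intervals, so cell \<open>j\<close> of block \<open>i\<close> gets the index
  \<open>i * m + j\<close>.\<close>

lemma sum_div_mod:
  fixes g :: "nat \<Rightarrow> nat \<Rightarrow> 'a::comm_monoid_add"
  assumes "0 < m"
  shows "(\<Sum>p<k*m. g (p div m) (p mod m)) = (\<Sum>i<k. \<Sum>j<m. g i j)"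
proof -
  have "(\<Sum>p<k*m. g (p div m) (p mod m)) = (\<Sum>i<k. \<Sum>p\<in>{i*m..<i*m+m}. g (p div m) (p mod m))"
    by (rule sum.nat_group[symmetric])
  also have "\<dots> = (\<Sum>i<k. \<Sum>j<m. g i j)"
  proof (rule sum.cong[OF refl])
    fix i
    show "(\<Sum>p\<in>{i*m..<i*m+m}. g (p div m) (p mod m)) = (\<Sum>j<m. g i j)"
      using assms sum.shift_bounds_nat_ivl[of "\<lambda>p. g (p div m) (p mod m)" 0 "i*m" m]
      by (simp add: lessThan_atLeast0 add.commute)
  qed
  finally show ?thesis .
qed

text \<open>Cutting each interval of a chain along its own grid gives a finer chain of no greater
  total length, so the \<open>\<delta>\<close> that works for \<open>f\<close> works uniformly over
  all grids.\<close>

lemma abs_cont_on_grid_var: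
  fixes f :: "real \<Rightarrow> real"
  assumes "abs_cont_on {0..} f" "0 < \<epsilon>"
  obtains \<delta> where "0 < \<delta>"
    "\<And>k a b g. interval_chain k a b \<Longrightarrow> (\<Sum>i<k. b i - a i) < \<delta> \<Longrightarrow>
       (\<And>i. g i \<in> grids) \<Longrightarrow> (\<Sum>i<k. grid_var f (g i) (a i) (b i)) < \<epsilon>"
proof -
  obtain \<delta> where \<delta>: "0 < \<delta>"
    "\<And>k a b. interval_chain k a b \<Longrightarrow> (\<Sum>i<k. b i - a i) < \<delta> \<Longrightarrow>
       (\<Sum>i<k. norm (f (b i) - f (a i))) < \<epsilon>"
    using abs_cont_on_atLeastE[OF assms] by blast
  show thesis
  proof (rule that[OF \<delta>(1)])
    fix k :: nat and a b :: "nat \<Rightarrow> real" and g :: "nat \<Rightarrow> nat \<times> (nat \<Rightarrow> real)"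
    assume ch: "interval_chain k a b" and len: "(\<Sum>i<k. b i - a i) < \<delta>"
      and g: "\<And>i. g i \<in> grids"
    have a: "\<And>i. i < k \<Longrightarrow> 0 \<le> a i" and ab: "\<And>i. i < k \<Longrightarrow> a i \<le> b i"
      and ord: "\<And>i. Suc i < k \<Longrightarrow> b i \<le> a (Suc i)"
      using ch by (auto simp: interval_chain_def)
    \<comment> \<open>All blocks get the same number \<open>m > 0\<close> of cells; a shorter grid
      is padded by repeating its last point, which adds only zero terms.\<close>
    define m where "m = Suc (\<Sum>i<k. fst (g i))"
    have m: "0 < m" by (simp add: m_def)
    have gm: "fst (g i) \<le> m" if "i < k" for i
      using member_le_sum[of i "{..<k}" "\<lambda>i. fst (g i)"] that by (simp add: m_def)
    define t where "t i j = snd (g i) (min j (fst (g i)))" for i j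
    have tm: "t i j \<le> t i (Suc j)" for i j
      unfolding t_def by (rule monoD[of "snd (g i)"]) (use g[of i] in \<open>auto simp: grids_def\<close>)
    define A where "A i j = clip (a i) (b i) (t i j)" for i j
    have Am: "A i j \<le> A i (Suc j)" for i j
      by (simp add: A_def clip_mono tm)
    have Ab: "a i \<le> A i j" "A i j \<le> b i" if "i < k" for i j
      using ab[OF that] by (auto simp: A_def clip_def)
    have "(\<Sum>p<k*m. norm (f (A (p div m) (Suc (p mod m))) - f (A (p div m) (p mod m)))) < \<epsilon>"
    proof (rule \<delta>(2))
      show "interval_chain (k*m) (\<lambda>p. A (p div m) (p mod m)) (\<lambda>p. A (p div m) (Suc (p mod m)))"
        unfolding interval_chain_def
      proof (intro conjI allI impI)
        fix p assume "p < k*m"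
        then have "p div m < k" by (simp add: less_mult_imp_div_less)
        then show "0 \<le> A (p div m) (p mod m)" using a Ab(1) by (meson order_trans)
        show "A (p div m) (p mod m) \<le> A (p div m) (Suc (p mod m))" by (rule Am)
      next
        fix p assume p: "Suc p < k*m"
        then have d: "Suc p div m < k" by (simp add: less_mult_imp_div_less)
        show "A (p div m) (Suc (p mod m)) \<le> A (Suc p div m) (Suc p mod m)"
        proof (cases "Suc (p mod m) = m")
          case True
          then have e: "Suc p div m = Suc (p div m)" by (simp add: div_Suc mod_Suc)
          have "A (p div m) (Suc (p mod m)) \<le> b (p div m)" using Ab(2) d e by simp
          also have "\<dots> \<le> a (Suc p div m)" using ord d e by simp
          also have "\<dots> \<le> A (Suc p div m) (Suc p mod m)" using Ab(1) d by simp
          finally show ?thesis .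
        next
          case False
          then show ?thesis by (simp add: div_Suc mod_Suc)
        qed
      qed
    next
      have "(\<Sum>p<k*m. A (p div m) (Suc (p mod m)) - A (p div m) (p mod m)) = (\<Sum>i<k. \<Sum>j<m. A i (Suc j) - A i j)"
        by (rule sum_div_mod[OF m])
      also have "\<dots> = (\<Sum>i<k. A i m - A i 0)" by (simp add: sum_lessThan_telescope)
      also have "\<dots> \<le> (\<Sum>i<k. b i - a i)" using Ab by (intro sum_mono diff_mono) auto
      finally show "(\<Sum>p<k*m. A (p div m) (Suc (p mod m)) - A (p div m) (p mod m)) < \<delta>" using len by simp
    qed
    also have "(\<Sum>p<k*m. norm (f (A (p div m) (Suc (p mod m))) - f (A (p div m) (p mod m))))
       = (\<Sum>i<k. \<Sum>j<m. norm (f (A i (Suc j)) - f (A i j)))"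
      by (rule sum_div_mod[OF m])
    also have "\<dots> = (\<Sum>i<k. grid_var f (g i) (a i) (b i))"
    proof (rule sum.cong[OF refl])
      fix i assume i: "i \<in> {..<k}"
      have "(\<Sum>j<m. norm (f (A i (Suc j)) - f (A i j))) = (\<Sum>j\<in>{..<fst (g i)}. norm (f (A i (Suc j)) - f (A i j)))"
        using gm[of i] i by (intro sum.mono_neutral_right) (auto simp: A_def t_def)
      then show "(\<Sum>j<m. norm (f (A i (Suc j)) - f (A i j))) = grid_var f (g i) (a i) (b i)"
        by (auto simp: grid_var_def A_def t_def intro!: sum.cong)
    qed
    finally show "(\<Sum>i<k. grid_var f (g i) (a i) (b i)) < \<epsilon>" .
  qed
qed

text \<open>With \<open>\<delta>\<close> taken for the tolerance \<open>1\<close>, windows shorter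
  than \<open>\<delta>\<close> have variation at most \<open>1\<close> on every grid, and finitely
  many steps of length \<open>\<delta> / 2\<close> lead from \<open>0\<close> at least to
  \<open>x\<close>.\<close>

lemma bdd_above_grid_var:
  fixes f :: "real \<Rightarrow> real"
  assumes "abs_cont_on {0..} f"
  shows "bdd_above ((\<lambda>g. grid_var f g 0 x) ` grids)"
proof -
  obtain \<delta> where \<delta>: "0 < \<delta>"
    "\<And>k a b g. interval_chain k a b \<Longrightarrow> (\<Sum>i<k. b i - a i) < \<delta> \<Longrightarrow>
       (\<And>i. g i \<in> grids) \<Longrightarrow> (\<Sum>i<k. grid_var f (g i) (a i) (b i)) < 1"
    using abs_cont_on_grid_var[OF assms zero_less_one] by blast
  have one: "grid_var f g a b \<le> 1" if "0 \<le> a" "a \<le> b" "b - a < \<delta>" "g \<in> grids" for a b g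
    using \<delta>(2)[of 1 "\<lambda>_. a" "\<lambda>_. b" "\<lambda>_. g"] that by (simp add: interval_chain_def)
  have zero: "grid_var f g 0 y = 0" if "y \<le> 0" for g y
  proof -
    have "clip 0 y t = 0" for t using that by (auto simp: clip_def)
    then show ?thesis by (simp add: grid_var_def)
  qed
  have step: "\<forall>g\<in>grids. \<forall>y. 0 \<le> y \<longrightarrow> y \<le> real N * (\<delta>/2) \<longrightarrow> grid_var f g 0 y \<le> real N" for N
  proof (induction N)
    case 0
    then show ?case using zero by auto
  next
    case (Suc N)
    show ?case
    proof (intro ballI allI impI)
      fix g y assume g: "g \<in> grids" and y: "0 \<le> y" "y \<le> real (Suc N) * (\<delta>/2)"
      define z where "z = min y (real N * (\<delta>/2))"
      have z: "0 \<le> z" "z \<le> y" "z \<le> real N * (\<delta>/2)" "y - z < \<delta>"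
        using y \<delta>(1) by (auto simp: z_def min_def algebra_simps)
      have "grid_var f g 0 y \<le> grid_var f g 0 z + grid_var f g z y" by (rule grid_var_add) (use z in auto)
      then show "grid_var f g 0 y \<le> real (Suc N)"
        using Suc.IH g z(1,3) one[OF z(1,2,4) g] by fastforce
    qed
  qed
  obtain N :: nat where N: "x / (\<delta>/2) \<le> real N" using real_arch_simple by blast
  have xN: "x \<le> real N * (\<delta>/2)" using N \<delta>(1) by (simp add: field_simps)
  have "grid_var f g 0 x \<le> real N" if "g \<in> grids" for g
  proof (cases "0 \<le> x")
    case True then show ?thesis using step xN that by blast
  next
    case False then show ?thesis using zero by simp
  qed
  then show ?thesis by (intro bdd_aboveI2)
qed

lemma grids_nonempty: "grids \<noteq> {}"
  proof -
  have "(0, \<lambda>_. 0) \<in> grids" by (simp add: grids_def mono_def)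
  then show ?thesis by blast
qed

text \<open>A grid on \<open>{0..a}\<close> extended by a last cell from \<open>a\<close> to
  \<open>b\<close> competes in the supremum for \<open>b\<close>. Hence \<open>total_var f\<close>
  and \<open>total_var f - f\<close> are both nondecreasing on the half-line.\<close>

lemma total_var_increment_ge:
  fixes f :: "real \<Rightarrow> real"
  assumes f: "abs_cont_on {0..} f" and ab: "0 \<le> a" "a \<le> b"
  shows "\<bar>f b - f a\<bar> \<le> total_var f b - total_var f a"
proof -
  have "grid_var f g 0 a + \<bar>f b - f a\<bar> \<le> total_var f b" if g: "g \<in> grids" for g
  proof -
    define m where "m = fst g"
    \<comment> \<open>The old points are clipped into the window first, so that \<open>a\<close> and
      \<open>b\<close> can be appended without breaking monotonicity.\<close>
    define t where "t j = (if j \<le> m then clip 0 a (snd g j) else if j = Suc m then a else b)" for j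
    have "mono t" unfolding mono_iff_le_Suc
    proof
      fix j
      show "t j \<le> t (Suc j)"
        using ab monoD[of "snd g" j "Suc j"] g
        by (auto simp: t_def clip_def grids_def)
    qed
    then have "(m+2, t) \<in> grids" by (simp add: grids_def)
    then have "grid_var f (m+2, t) 0 b \<le> total_var f b"
      unfolding total_var_def by (intro cSUP_upper bdd_above_grid_var f)
    moreover have "grid_var f (m+2, t) 0 b \<ge> grid_var f g 0 a + \<bar>f b - f a\<bar>"
    proof -
      have c: "clip 0 b (t j) = t j" for j
        using ab by (auto simp: t_def clip_def)
      have "grid_var f (m+2, t) 0 b = (\<Sum>j<m. \<bar>f (t (Suc j)) - f (t j)\<bar>) + \<bar>f (t (Suc m)) - f (t m)\<bar> + \<bar>f (t (Suc (Suc m))) - f (t (Suc m))\<bar>"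
        by (simp add: grid_var_def c)
      moreover have "(\<Sum>j<m. \<bar>f (t (Suc j)) - f (t j)\<bar>) = grid_var f g 0 a"
        unfolding grid_var_def m_def[symmetric] by (intro sum.cong) (auto simp: t_def)
      moreover have "t (Suc m) = a" "t (Suc (Suc m)) = b" by (auto simp: t_def)
      ultimately show ?thesis by simp
    qed
    ultimately show ?thesis by linarith
  qed
  then have "total_var f a \<le> total_var f b - \<bar>f b - f a\<bar>"
    unfolding total_var_def[of f a] by (intro cSUP_least grids_nonempty) (simp add: algebra_simps)
  then show ?thesis by simp
qed

text \<open>Near-optimal grids for the suprema at the right endpoints lose little, and by
  subadditivity their variation over the windows \<open>{a i..b i}\<close> bounds the increments;
  absolute continuity of \<open>f\<close> controls all these windows at once.\<close>

lemma abs_cont_on_total_var: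
  fixes f :: "real \<Rightarrow> real"
  assumes f: "abs_cont_on {0..} f"
  shows "abs_cont_on {0..} (total_var f)"
  unfolding abs_cont_on_atLeast_iff
proof (intro allI impI)
  fix \<epsilon> :: real assume e: "0 < \<epsilon>"
  then have e2: "0 < \<epsilon>/2" by simp
  obtain \<delta> where \<delta>: "0 < \<delta>"
    "\<And>k a b g. interval_chain k a b \<Longrightarrow> (\<Sum>i<k. b i - a i) < \<delta> \<Longrightarrow>
       (\<And>i. g i \<in> grids) \<Longrightarrow> (\<Sum>i<k. grid_var f (g i) (a i) (b i)) < \<epsilon>/2"
    using abs_cont_on_grid_var[OF f e2] by blast
  show "\<exists>\<delta>>0. \<forall>k a b. interval_chain k a b \<and>
        (\<Sum>i<k. b i - a i) < \<delta> \<longrightarrow> (\<Sum>j<k. norm (total_var f (b j) - total_var f (a j))) < \<epsilon>"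
  proof (intro exI[of _ \<delta>] conjI allI impI \<delta>(1))
    fix k :: nat and a b :: "nat \<Rightarrow> real"
    assume *: "interval_chain k a b \<and> (\<Sum>i<k. b i - a i) < \<delta>"
    \<comment> \<open>The \<open>k\<close> grids together lose at most
      \<open>k * \<eta> \<le> \<epsilon> / 2\<close>; the summand \<open>1\<close> covers
      \<open>k = 0\<close>.\<close>
    define \<eta> where "\<eta> = \<epsilon> / 2 / (real k + 1)"
    have \<eta>: "0 < \<eta>" using e by (simp add: \<eta>_def)
    have "\<exists>g\<in>grids. total_var f (b i) - \<eta> < grid_var f g 0 (b i)" for i
      unfolding total_var_def
      using less_cSUP_iff[OF grids_nonempty bdd_above_grid_var[OF f]] \<eta>
      by (metis diff_less_eq less_add_same_cancel1)
    then obtain g where g: "\<And>i. g i \<in> grids" "\<And>i. total_var f (b i) - \<eta> < grid_var f (g i) 0 (b i)"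
      by metis
    have "norm (total_var f (b i) - total_var f (a i)) \<le> grid_var f (g i) (a i) (b i) + \<eta>" if "i < k" for i
    proof -
      have "grid_var f (g i) 0 (a i) \<le> total_var f (a i)"
        unfolding total_var_def by (intro cSUP_upper bdd_above_grid_var f g)
      moreover have "grid_var f (g i) 0 (b i) \<le> grid_var f (g i) 0 (a i) + grid_var f (g i) (a i) (b i)"
        using * that by (intro grid_var_add) (auto simp: interval_chain_def)
      moreover have "\<bar>f (b i) - f (a i)\<bar> \<le> total_var f (b i) - total_var f (a i)"
        using * that by (intro total_var_increment_ge f) (auto simp: interval_chain_def)
      ultimately show ?thesis using g(2)[of i] by simp
    qed
    then have "(\<Sum>i<k. norm (total_var f (b i) - total_var f (a i))) \<le> (\<Sum>i<k. grid_var f (g i) (a i) (b i) + \<eta>)"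
      by (intro sum_mono) auto
    also have "\<dots> = (\<Sum>i<k. grid_var f (g i) (a i) (b i)) + real k * \<eta>" by (simp add: sum.distrib)
    also have "\<dots> < \<epsilon>/2 + \<epsilon>/2"
    proof (rule add_less_le_mono)
      show "(\<Sum>i<k. grid_var f (g i) (a i) (b i)) < \<epsilon>/2" using * g by (intro \<delta>(2)) auto
      show "real k * \<eta> \<le> \<epsilon>/2" using e by (simp add: \<eta>_def field_simps)
    qed
    finally show "(\<Sum>i<k. norm (total_var f (b i) - total_var f (a i))) < \<epsilon>" by simp
  qed
qed

section \<open>Stieltjes measures and densities\<close>

text \<open>Half-open cells of one level are disjoint and split exactly into cells of the next
  level, and the Stieltjes measure of such a cell is an increment.\<close>

definition dyadic_Ioc :: "nat \<Rightarrow> nat \<Rightarrow> real set" where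
  "dyadic_Ioc n j = {real j / 2^n <.. (real j + 1) / 2^n}"

lemma dyadic_Ioc_refine:
  assumes "x \<in> dyadic_Ioc n j"
  shows "\<exists>j'\<in>{2*j, 2*j+1}. x \<in> dyadic_Ioc (Suc n) j' \<and> dyadic_Ioc (Suc n) j' \<subseteq> dyadic_Ioc n j"
proof (cases "x \<le> (2 * real j + 1) / 2^Suc n")
  case True
  with assms have "x \<in> dyadic_Ioc (Suc n) (2*j)" by (auto simp: dyadic_Ioc_def)
  moreover have "dyadic_Ioc (Suc n) (2*j) \<subseteq> dyadic_Ioc n j" by (auto simp: dyadic_Ioc_def field_simps)
  ultimately show ?thesis by blast
next
  case False
  with assms have "x \<in> dyadic_Ioc (Suc n) (2*j+1)" by (auto simp: dyadic_Ioc_def field_simps)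
  moreover have "dyadic_Ioc (Suc n) (2*j+1) \<subseteq> dyadic_Ioc n j" by (auto simp: dyadic_Ioc_def field_simps)
  ultimately show ?thesis by blast
qed

text \<open>The \<open>4^n\<close> cells of level \<open>n\<close> reach only up to
  \<open>2^n\<close>. The level is therefore chosen large enough both to reach \<open>x\<close> and
  to make the cells shorter than \<open>e\<close>.\<close>

lemma ex_dyadic_Ioc:
  fixes x e :: real
  assumes "0 < x" "0 < e"
  obtains n j where "j < 4^n" "x \<in> dyadic_Ioc n j" "dyadic_Ioc n j \<subseteq> ball x e"
proof -
  obtain n1 where n1: "(1/2)^n1 < e" using real_arch_pow_inv[of e "1/2"] assms by auto
  obtain n2 where n2: "x < 2^n2" using real_arch_pow[of 2 x] by auto
  define n where "n = max n1 n2"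
  have "(1/2::real)^n \<le> (1/2)^n1" by (intro power_decreasing) (auto simp: n_def)
  then have e: "1 / 2^n < e" using n1 by (simp add: power_one_over)
  have "(2::real)^n2 \<le> 2^n" by (intro power_increasing) (auto simp: n_def)
  then have x: "x < 2^n" by (rule order_less_le_trans[OF n2])
  \<comment> \<open>Cells are closed on the right, so the index is the ceiling minus one, not the
    floor.\<close>
  define j where "j = nat (\<lceil>x * 2^n\<rceil> - 1)"
  have c: "1 \<le> \<lceil>x * 2^n\<rceil>" using assms by (simp add: one_le_ceiling)
  have j: "real j = of_int \<lceil>x * 2^n\<rceil> - 1" using c by (simp add: j_def)
  have j1: "real j < x * 2^n" "x * 2^n \<le> real j + 1" using j by linarith+
  show thesis
  proof
    have "real j < 2^n * 2^n" using j1(1) x by (smt (verit) mult_right_mono zero_le_power)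
    also have "(2::real)^n * 2^n = 4^n" by (simp flip: power_mult_distrib)
    finally have "real j < real (4^n)" by simp
    then show "j < 4^n" by (simp only: of_nat_less_iff)
    show "x \<in> dyadic_Ioc n j" using j1 by (auto simp: dyadic_Ioc_def field_simps)
    then show "dyadic_Ioc n j \<subseteq> ball x e"
      using e by (auto simp: dyadic_Ioc_def dist_real_def add_divide_distrib abs_if)
  qed
qed

lemma disjoint_dyadic_Ioc: "disjoint_family_on (dyadic_Ioc n) I"
  unfolding disjoint_family_on_def
proof (intro ballI impI)
  fix i j :: nat assume "i \<noteq> j"
  then have "real i + 1 \<le> real j \<or> real j + 1 \<le> real i" by linarith
  then have "(real i + 1)/2^n \<le> real j/2^n \<or> (real j + 1)/2^n \<le> real i/2^n"
    by (auto intro!: divide_right_mono)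
  then show "dyadic_Ioc n i \<inter> dyadic_Ioc n j = {}" by (auto simp: dyadic_Ioc_def)
qed

lemma abs_cont_on_imp_continuous_clamped:
  fixes G :: "real \<Rightarrow> real"
  assumes ac: "abs_cont_on {0..} G"
  shows "continuous_on UNIV (\<lambda>x. G (max 0 x))"
  unfolding continuous_on_iff
proof (intro ballI allI impI)
  fix x e :: real assume e: "0 < e"
  obtain \<delta> where \<delta>: "0 < \<delta>"
    "\<And>k a b. interval_chain k a b \<Longrightarrow> (\<Sum>i<k. b i - a i) < \<delta> \<Longrightarrow>
       (\<Sum>i<k. norm (G (b i) - G (a i))) < e"
    using abs_cont_on_atLeastE[OF ac e] by blast
  have one: "\<bar>G b - G a\<bar> < e" if "0 \<le> a" "a \<le> b" "b - a < \<delta>" for a b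
    using \<delta>(2)[of 1 "\<lambda>_. a" "\<lambda>_. b"] that by (simp add: interval_chain_def)
  show "\<exists>d>0. \<forall>y\<in>UNIV. dist y x < d \<longrightarrow> dist (G (max 0 y)) (G (max 0 x)) < e"
  proof (intro exI[of _ \<delta>] conjI ballI impI \<delta>(1))
    fix y assume "dist y x < \<delta>"
    then have d: "\<bar>max 0 y - max 0 x\<bar> < \<delta>" by (auto simp: dist_real_def)
    show "dist (G (max 0 y)) (G (max 0 x)) < e"
    proof (cases "max 0 x \<le> max 0 y")
      case True
      have "\<bar>G (max 0 y) - G (max 0 x)\<bar> < e" by (rule one) (use True d in linarith)+
      then show ?thesis by (simp add: dist_real_def)
    next
      case False
      have "\<bar>G (max 0 x) - G (max 0 y)\<bar> < e" by (rule one) (use False d in linarith)+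
      then show ?thesis by (simp add: dist_real_def abs_minus_commute)
    qed
  qed
qed

text \<open>A null set has an open neighbourhood \<open>U\<close> of Lebesgue measure below
  \<open>\<delta>\<close>. The part of \<open>U\<close> in the positive half-line is exhausted by
  finite unions of dyadic cells; each union forms a chain of length below \<open>\<delta>\<close>,
  so its Stieltjes measure is at most \<open>\<epsilon>\<close>.\<close>

lemma absolutely_continuous_interval_measure:
  fixes G :: "real \<Rightarrow> real"
  assumes ac: "abs_cont_on {0..} G" and mono: "\<And>x y. 0 \<le> x \<Longrightarrow> x \<le> y \<Longrightarrow> G x \<le> G y"
  shows "absolutely_continuous lborel (interval_measure (\<lambda>x. G (max 0 x)))"
proof -
  define H where "H = (\<lambda>x. G (max 0 x))"
  have Hm: "H x \<le> H y" if "x \<le> y" for x y using that by (auto simp: H_def intro: mono)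
  have Hc: "continuous_on UNIV H" unfolding H_def by (rule abs_cont_on_imp_continuous_clamped[OF ac])
  have Hr: "continuous (at_right a) H" for a
    using Hc by (auto intro: continuous_within_subset simp: continuous_on_eq_continuous_within)
  define \<mu> where "\<mu> = interval_measure H"
  have sets_\<mu>[measurable_cong]: "sets \<mu> = sets borel" by (simp add: \<mu>_def)
  note Ioc = emeasure_interval_measure_Ioc[OF _ Hm Hr, folded \<mu>_def]
  \<comment> \<open>The clamped function is constant here, so all the mass sits on the positive
    half-line.\<close>
  have neg: "emeasure \<mu> {..0} = 0"
  proof -
    have "(\<Union>i::nat. {- real i<..0}) = {..0::real}"
    proof (intro equalityI subsetI)
      fix x :: real assume "x \<in> {..0}"
      moreover obtain i :: nat where "- x < real i" using reals_Archimedean2 by blast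
      ultimately show "x \<in> (\<Union>i::nat. {- real i<..0})" by (auto intro!: exI[of _ i])
    qed auto
    moreover have "emeasure \<mu> (\<Union>i::nat. {- real i<..0}) = 0"
    proof (rule emeasure_UN_eq_0)
      show "emeasure \<mu> {- real i<..0} = 0" for i by (subst Ioc) (auto simp: H_def)
      show "range (\<lambda>i. {- real i<..0}) \<subseteq> sets \<mu>" by (auto simp: sets_\<mu>)
    qed
    ultimately show ?thesis by simp
  qed
  have "emeasure \<mu> N \<le> ennreal \<epsilon>" if N: "N \<in> null_sets lborel" and e: "0 < \<epsilon>" for N \<epsilon>
  proof -
    obtain \<delta> where \<delta>: "0 < \<delta>"
      "\<And>k a b. interval_chain k a b \<Longrightarrow> (\<Sum>i<k. b i - a i) < \<delta> \<Longrightarrow>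
         (\<Sum>i<k. norm (G (b i) - G (a i))) < \<epsilon>"
      using abs_cont_on_atLeastE[OF ac e] by blast
    have Nb: "N \<in> sets borel" using N by auto
    obtain U where U: "open U" "N \<subseteq> U" "emeasure lborel (U - N) < \<delta>"
      using outer_regular_lborel[OF Nb \<delta>(1)] by blast
    have Ub[measurable]: "U \<in> sets borel" using U by simp
    have U\<delta>: "emeasure lborel U < \<delta>"
      using U(3) emeasure_Diff_null_set[OF N, of U] by simp
    \<comment> \<open>The cutoff \<open>4^n\<close> keeps the cells of level \<open>n\<close> finite
      in number and still lets the two halves of a kept cell be kept.\<close>
    define J where "J n = {j. j < 4^n \<and> dyadic_Ioc n j \<subseteq> U}" for n
    define A where "A n = (\<Union>j\<in>J n. dyadic_Ioc n j)" for n
    have fJ: "finite (J n)" for n by (simp add: J_def)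
    have Dm[measurable]: "dyadic_Ioc n j \<in> sets borel" for n j by (simp add: dyadic_Ioc_def)
    have Am[measurable]: "A n \<in> sets borel" for n unfolding A_def using fJ by measurable
    have inc: "incseq A"
    proof (rule incseq_SucI, rule subsetI)
      fix n x assume "x \<in> A n"
      then obtain j where j: "j < 4^n" "dyadic_Ioc n j \<subseteq> U" "x \<in> dyadic_Ioc n j" by (auto simp: A_def J_def)
      obtain j' where j': "j' \<in> {2*j, 2*j+1}" "x \<in> dyadic_Ioc (Suc n) j'" "dyadic_Ioc (Suc n) j' \<subseteq> dyadic_Ioc n j"
        using dyadic_Ioc_refine[OF j(3)] by blast
      have "j' < 4^Suc n" using j(1) j'(1) by auto
      then show "x \<in> A (Suc n)" using j j' by (auto simp: A_def J_def)
    qed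
    have cov: "U \<subseteq> {..0} \<union> (\<Union>n. A n)"
    proof
      fix x assume x: "x \<in> U"
      show "x \<in> {..0} \<union> (\<Union>n. A n)"
      proof (cases "0 < x")
        case True
        obtain e where "0 < e" "ball x e \<subseteq> U" using U(1) x open_contains_ball by blast
        then obtain n j where "j < 4^n" "x \<in> dyadic_Ioc n j" "dyadic_Ioc n j \<subseteq> U"
          using ex_dyadic_Ioc[OF True \<open>0 < e\<close>] by (metis order_trans)
        then show ?thesis by (auto simp: A_def J_def)
      qed auto
    qed
    have An: "emeasure \<mu> (A n) \<le> ennreal \<epsilon>" for n
    proof -
      define a where "a j = real j / 2^n" for j :: nat
      \<comment> \<open>Cells outside \<open>U\<close> are kept as degenerate intervals, so the chain needs no reordering.\<close>
      define b where "b j = (if j \<in> J n then (real j + 1) / 2^n else real j / 2^n)" for j :: nat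
      have ch: "interval_chain (4^n) a b"
        by (auto simp: interval_chain_def a_def b_def field_simps)
      have "ennreal (\<Sum>j<4^n. b j - a j) = (\<Sum>j<4^n. ennreal (b j - a j))"
        by (subst sum_ennreal) (auto simp: a_def b_def field_simps)
      also have "\<dots> = (\<Sum>j\<in>J n. emeasure lborel (dyadic_Ioc n j))"
        by (rule sum.mono_neutral_cong_right) (auto simp: J_def a_def b_def dyadic_Ioc_def divide_right_mono)
      also have "\<dots> = emeasure lborel (A n)"
        unfolding A_def by (rule sum_emeasure) (auto simp: fJ disjoint_dyadic_Ioc)
      also have "\<dots> \<le> emeasure lborel U" by (rule emeasure_mono) (auto simp: A_def J_def)
      also have "\<dots> < \<delta>" by (rule U\<delta>)
      finally have "(\<Sum>j<4^n. b j - a j) < \<delta>"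
        using \<delta>(1) by (simp add: ennreal_less_iff sum_nonneg a_def b_def divide_right_mono)
      then have s: "(\<Sum>j<4^n. norm (G (b j) - G (a j))) < \<epsilon>" by (rule \<delta>(2)[OF ch])
      have "emeasure \<mu> (A n) \<le> (\<Sum>j\<in>J n. emeasure \<mu> (dyadic_Ioc n j))"
        unfolding A_def by (rule emeasure_subadditive_finite) (auto simp: fJ sets_\<mu>)
      also have "\<dots> = (\<Sum>j\<in>J n. ennreal (norm (G (b j) - G (a j))))"
      proof (rule sum.cong[OF refl])
        fix j assume j: "j \<in> J n"
        have "emeasure \<mu> (dyadic_Ioc n j) = H (b j) - H (a j)"
          using j by (simp add: dyadic_Ioc_def Ioc a_def b_def divide_right_mono)
        moreover have "0 \<le> a j" "a j \<le> b j" by (auto simp: a_def b_def divide_right_mono)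
        moreover from this have "G (a j) \<le> G (b j)" by (rule mono)
        ultimately show "emeasure \<mu> (dyadic_Ioc n j) = ennreal (norm (G (b j) - G (a j)))"
          by (simp add: H_def)
      qed
      also have "\<dots> \<le> (\<Sum>j<4^n. ennreal (norm (G (b j) - G (a j))))"
        by (rule sum_mono2) (auto simp: J_def)
      also have "\<dots> = ennreal (\<Sum>j<4^n. norm (G (b j) - G (a j)))" by (simp add: sum_ennreal)
      also have "\<dots> \<le> ennreal \<epsilon>" using s by (intro ennreal_leI) simp
      finally show ?thesis .
    qed
    have "emeasure \<mu> N \<le> emeasure \<mu> ({..0} \<union> (\<Union>n. A n))"
      using U(2) cov by (intro emeasure_mono) (auto simp: sets_\<mu>)
    also have "\<dots> \<le> emeasure \<mu> {..0} + emeasure \<mu> (\<Union>n. A n)"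
      by (intro emeasure_subadditive) (auto simp: sets_\<mu>)
    also have "emeasure \<mu> (\<Union>n. A n) = (SUP n. emeasure \<mu> (A n))"
      using inc by (intro SUP_emeasure_incseq[symmetric]) (auto simp: sets_\<mu>)
    also have "\<dots> \<le> ennreal \<epsilon>" using An by (intro SUP_least)
    finally show ?thesis by (simp add: neg)
  qed
  then have "emeasure \<mu> N = 0" if "N \<in> null_sets lborel" for N
    using that by (metis ennreal_le_epsilon add_0 le_zero_eq)
  then show ?thesis
    unfolding absolutely_continuous_def \<mu>_def H_def by (auto simp: null_sets_def)
qed

text \<open>The density is the Radon-Nikodym derivative of the Stieltjes measure; continuity of the
  clamped \<open>G\<close> makes the measure of a closed interval equal to the increment.\<close>

lemma mono_abs_cont_on_has_integral:
  fixes G :: "real \<Rightarrow> real"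
  assumes ac: "abs_cont_on {0..} G" and mono: "\<And>x y. 0 \<le> x \<Longrightarrow> x \<le> y \<Longrightarrow> G x \<le> G y"
  obtains \<phi> where "\<phi> \<in> borel_measurable borel"
    "\<And>x y. x \<le> y \<Longrightarrow> (\<phi> has_integral (G (max 0 y) - G (max 0 x))) {x..y}"
proof -
  define H where "H = (\<lambda>x. G (max 0 x))"
  have Hm: "H x \<le> H y" if "x \<le> y" for x y using that by (auto simp: H_def intro: mono)
  have Hc: "continuous_on UNIV H" unfolding H_def by (rule abs_cont_on_imp_continuous_clamped[OF ac])
  have Hr: "continuous (at_right a) H" for a
    using Hc by (auto intro: continuous_within_subset simp: continuous_on_eq_continuous_within)
  define \<mu> where "\<mu> = interval_measure H"
  have ac\<mu>: "absolutely_continuous lborel \<mu>"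
    unfolding \<mu>_def H_def by (rule absolutely_continuous_interval_measure[OF ac mono])
  have sets_\<mu>: "sets \<mu> = sets lborel" by (simp add: \<mu>_def)
  have sf: "sigma_finite_measure \<mu>" unfolding \<mu>_def by (rule sigma_finite_interval_measure[OF Hm Hr])
  define D where "D = RN_deriv lborel \<mu>"
  have D: "density lborel D = \<mu>" unfolding D_def by (rule sigma_finite_measure.density_RN_deriv[OF sigma_finite_lborel ac\<mu> sets_\<mu>])
  have Dm[measurable]: "D \<in> borel_measurable borel"
    using borel_measurable_RN_deriv[of lborel \<mu>] by (simp add: D_def)
  \<comment> \<open>Sigma-finiteness of the Stieltjes measure makes \<open>D\<close> finite almost
    everywhere, so replacing it by \<open>enn2real\<close> does not change integrals.\<close>
  have Df: "AE x in lborel. D x \<noteq> \<infinity>" unfolding D_def by (rule sigma_finite_measure.RN_deriv_finite[OF sigma_finite_lborel sf ac\<mu> sets_\<mu>])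
  show thesis
  proof (rule that[of "\<lambda>x. enn2real (D x)"])
    show "(\<lambda>x. enn2real (D x)) \<in> borel_measurable borel" by measurable
    fix x y :: real assume xy: "x \<le> y"
    have "(\<integral>\<^sup>+t. ennreal (enn2real (D t) * indicator {x..y} t) \<partial>lborel) = (\<integral>\<^sup>+t. D t * indicator {x..y} t \<partial>lborel)"
      using Df by (intro nn_integral_cong_AE) (auto elim!: eventually_mono simp: indicator_def top.not_eq_extremum)
    also have "\<dots> = emeasure \<mu> {x..y}" by (subst D[symmetric]) (simp add: emeasure_density)
    also have "\<dots> = ennreal (H y - H x)"
      unfolding \<mu>_def by (rule emeasure_interval_measure_Icc[OF xy Hm Hc])
    finally have "((\<lambda>t. enn2real (D t) * indicator {x..y} t) has_integral (H y - H x)) UNIV"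
      using Hm[OF xy] by (intro nn_integral_has_integral) auto
    then have "((\<lambda>t. if t \<in> {x..y} then enn2real (D t) else 0) has_integral (H y - H x)) UNIV"
      by (rule has_integral_eq[rotated]) (auto simp: indicator_def)
    then show "((\<lambda>x. enn2real (D x)) has_integral (G (max 0 y) - G (max 0 x))) {x..y}"
      by (simp only: H_def has_integral_restrict_UNIV)
  qed
qed

text \<open>Jordan decomposition: \<open>f\<close> is \<open>total_var f\<close> minus
  \<open>total_var f - f\<close>, both nondecreasing and absolutely continuous, and the two
  densities subtract.\<close>

lemma abs_cont_on_real_has_integral:
  fixes f :: "real \<Rightarrow> real"
  assumes ac: "abs_cont_on {0..} f"
  obtains \<phi> where "\<phi> \<in> borel_measurable borel"
    "\<And>x y. x \<le> y \<Longrightarrow> (\<phi> has_integral (f (max 0 y) - f (max 0 x))) {x..y}"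
proof -
  note acV = abs_cont_on_total_var[OF ac]
  note inc = total_var_increment_ge[OF ac]
  have 1: "total_var f x \<le> total_var f y" if "0 \<le> x" "x \<le> y" for x y
    using inc[OF that] by simp
  have 2: "total_var f x - f x \<le> total_var f y - f y" if "0 \<le> x" "x \<le> y" for x y
    using inc[OF that] by simp
  obtain \<phi> where \<phi>[measurable]: "\<phi> \<in> borel_measurable borel"
    "\<And>x y. x \<le> y \<Longrightarrow> (\<phi> has_integral (total_var f (max 0 y) - total_var f (max 0 x))) {x..y}"
    using mono_abs_cont_on_has_integral[OF acV 1] by blast
  obtain \<psi> where \<psi>[measurable]: "\<psi> \<in> borel_measurable borel"
    "\<And>x y. x \<le> y \<Longrightarrow> (\<psi> has_integral ((total_var f (max 0 y) - f (max 0 y)) - (total_var f (max 0 x) - f (max 0 x)))) {x..y}"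
    using mono_abs_cont_on_has_integral[OF abs_cont_on_atLeast_diff[OF acV ac] 2] by blast
  show thesis
  proof (rule that[of "\<lambda>x. \<phi> x - \<psi> x"])
    show "(\<lambda>x. \<phi> x - \<psi> x) \<in> borel_measurable borel" by measurable
    fix x y :: real assume "x \<le> y"
    from has_integral_diff[OF \<phi>(2)[OF this] \<psi>(2)[OF this]]
    show "((\<lambda>x. \<phi> x - \<psi> x) has_integral (f (max 0 y) - f (max 0 x))) {x..y}" by simp
  qed
qed

lemma abs_cont_on_has_integral:
  fixes h :: "real \<Rightarrow> real^'n"
  assumes ac: "abs_cont_on {0..} h"
  obtains \<phi> where "\<phi> \<in> borel_measurable borel"
    "\<And>x y. x \<le> y \<Longrightarrow> (\<phi> has_integral (h (max 0 y) - h (max 0 x))) {x..y}"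
proof -
  have "\<exists>\<phi>. \<phi> \<in> borel_measurable borel \<and>
      (\<forall>x y. x \<le> y \<longrightarrow> (\<phi> has_integral (h (max 0 y) $ i - h (max 0 x) $ i)) {x..y})" for i
    using abs_cont_on_real_has_integral[OF abs_cont_on_atLeast_component[OF ac, of i]] by metis
  then obtain \<phi> where \<phi>: "\<And>i. \<phi> i \<in> borel_measurable borel"
      "\<And>i x y. x \<le> y \<Longrightarrow> (\<phi> i has_integral (h (max 0 y) $ i - h (max 0 x) $ i)) {x..y}"
    by metis
  show thesis
  proof (rule that[of "\<lambda>t. \<chi> i. \<phi> i t"])
    show "(\<lambda>t. \<chi> i. \<phi> i t) \<in> borel_measurable borel"
      by (subst borel_measurable_euclidean_space) (auto simp: Basis_vec_def inner_axis intro: \<phi>)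
    fix x y :: real assume "x \<le> y"
    then show "((\<lambda>t. \<chi> i. \<phi> i t) has_integral (h (max 0 y) - h (max 0 x))) {x..y}"
      by (subst has_integral_componentwise_iff) (auto simp: Basis_vec_def inner_axis intro: \<phi>)
  qed
qed

section \<open>Derivatives and energy of Cameron-Martin paths\<close>

text \<open>The library's differentiation theorem only yields right derivatives; the left ones come from
  applying it to the reflected integrand.\<close>
lemma indefinite_integral_has_vector_derivative_ae:
  fixes \<phi> :: "real \<Rightarrow> 'b::euclidean_space"
  assumes H: "\<And>x y. x \<le> y \<Longrightarrow> (\<phi> has_integral (H y - H x)) {x..y}"
  shows "AE x in lebesgue. (H has_vector_derivative \<phi> x) (at x)"
proof -
  have int: "\<phi> integrable_on cbox a b" for a b
    using H[of a b] by (cases "a \<le> b") (auto simp: integrable_on_def)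
  have reflect: "((\<lambda>x. \<phi> (- x)) has_integral (H (- x) - H (- y))) {x..y}" if "x \<le> y" for x y
    using H[of "-y" "-x"] that has_integral_reflect_real[of \<phi> "H (- x) - H (- y)" "-x" "-y"] by simp
  have int': "(\<lambda>x. \<phi> (- x)) integrable_on cbox a b" for a b
    using reflect[of a b] by (cases "a \<le> b") (auto simp: integrable_on_def)
  obtain N1 where N1: "negligible N1"
    "\<And>x e. \<lbrakk>x \<notin> N1; 0 < e\<rbrakk> \<Longrightarrow> \<exists>d>0. \<forall>h. 0 < h \<and> h < d \<longrightarrow>
       norm (integral (cbox x (x + h *\<^sub>R One)) \<phi> /\<^sub>R h ^ DIM(real) - \<phi> x) < e"
    using integrable_ccontinuous_explicit[OF int] by blast
  obtain N2 where N2: "negligible N2"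
    "\<And>x e. \<lbrakk>x \<notin> N2; 0 < e\<rbrakk> \<Longrightarrow> \<exists>d>0. \<forall>h. 0 < h \<and> h < d \<longrightarrow>
       norm (integral (cbox x (x + h *\<^sub>R One)) (\<lambda>x. \<phi> (- x)) /\<^sub>R h ^ DIM(real) - \<phi> (- x)) < e"
    using integrable_ccontinuous_explicit[OF int'] by blast
  \<comment> \<open>Exceptional points of the reflected integrand live at \<open>- x\<close>, so
    that set is reflected back before taking the union.\<close>
  have "negligible (uminus ` N2)"
    using N2(1) by (intro negligible_differentiable_image_negligible) (auto intro!: derivative_intros)
  then have "negligible (N1 \<union> uminus ` N2)" using N1(1) by (rule negligible_Un[rotated])
  moreover have "(H has_vector_derivative \<phi> x) (at x)" if x: "x \<notin> N1 \<union> uminus ` N2" for x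
    unfolding has_vector_derivative_def has_derivative_at_alt
  proof (intro conjI allI impI bounded_linear_scaleR_left)
    fix e :: real assume e: "0 < e"
    have x2: "- x \<notin> N2" using x by force
    obtain d1 where d1: "0 < d1" "\<And>h. 0 < h \<Longrightarrow> h < d1 \<Longrightarrow> norm (integral {x..x+h} \<phi> /\<^sub>R h - \<phi> x) < e"
      using N1(2)[of x e] x e by auto
    obtain d2 where d2: "0 < d2"
      "\<And>h. 0 < h \<Longrightarrow> h < d2 \<Longrightarrow> norm (integral {-x..-x+h} (\<lambda>x. \<phi> (- x)) /\<^sub>R h - \<phi> x) < e"
      using N2(2)[OF x2 e] by auto
    show "\<exists>d>0. \<forall>y. norm (y - x) < d \<longrightarrow> norm (H y - H x - (y - x) *\<^sub>R \<phi> x) \<le> e * norm (y - x)"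
    proof (intro exI[of _ "min d1 d2"] conjI allI impI)
      show "0 < min d1 d2" using d1 d2 by simp
      fix y assume y: "norm (y - x) < min d1 d2"
      consider "y = x" | "x < y" | "y < x" by linarith
      then show "norm (H y - H x - (y - x) *\<^sub>R \<phi> x) \<le> e * norm (y - x)"
      proof cases
        case 2
        define s where "s = y - x"
        have s: "0 < s" "s < d1" using 2 y by (auto simp: s_def)
        have "integral {x..x+s} \<phi> = H y - H x"
          using H[of x y] 2 by (intro integral_unique) (simp add: s_def)
        then have "norm ((H y - H x) /\<^sub>R s - \<phi> x) < e" using d1(2)[OF s] by simp
        then have "s * norm ((H y - H x) /\<^sub>R s - \<phi> x) \<le> s * e" using s by simp
        also have "s * norm ((H y - H x) /\<^sub>R s - \<phi> x) = norm (s *\<^sub>R ((H y - H x) /\<^sub>R s - \<phi> x))" using s by simp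
        also have "s *\<^sub>R ((H y - H x) /\<^sub>R s - \<phi> x) = H y - H x - s *\<^sub>R \<phi> x"
          using s by (simp add: scaleR_diff_right)
        finally show ?thesis using s by (simp add: s_def mult.commute)
      next
        case 3
        define s where "s = x - y"
        have s: "0 < s" "s < d2" using 3 y by (auto simp: s_def)
        have "integral {-x..-x+s} (\<lambda>x. \<phi> (- x)) = H x - H y"
          using reflect[of "-x" "-y"] 3 by (intro integral_unique) (simp add: s_def)
        then have "norm ((H x - H y) /\<^sub>R s - \<phi> x) < e" using d2(2)[OF s] by simp
        then have "s * norm ((H x - H y) /\<^sub>R s - \<phi> x) \<le> s * e" using s by simp
        also have "s * norm ((H x - H y) /\<^sub>R s - \<phi> x) = norm (s *\<^sub>R ((H x - H y) /\<^sub>R s - \<phi> x))" using s by simp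
        also have "s *\<^sub>R ((H x - H y) /\<^sub>R s - \<phi> x) = H x - H y - s *\<^sub>R \<phi> x"
          using s by (simp add: scaleR_diff_right)
        also have "norm \<dots> = norm (H y - H x - (y - x) *\<^sub>R \<phi> x)"
          by (subst norm_minus_cancel[symmetric]) (simp add: s_def algebra_simps)
        finally show ?thesis using s by (simp add: s_def mult.commute)
      qed auto
    qed
  qed
  ultimately show ?thesis
    by (intro AE_I'[of "N1 \<union> uminus ` N2"]) (auto simp: negligible_iff_null_sets)
qed

text \<open>Paths in \<open>P0\<close> vanish on the negative axis, so the clamp at \<open>0\<close>
  has no effect and one density serves on the whole line.\<close>

lemma CM_has_density:
  assumes "h \<in> CM"
  obtains \<phi> where "\<phi> \<in> borel_measurable borel"
    "\<And>x y. x \<le> y \<Longrightarrow> (\<phi> has_integral (h y - h x)) {x..y}"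
    "AE t in lebesgue. (h has_vector_derivative \<phi> t) (at t)"
proof -
  have ac: "abs_cont_on {0..} h" and h: "h \<in> P0" using assms by (auto simp: CM_def)
  have hm: "h (max 0 x) = h x" for x using h by (auto simp: P0_def max_def)
  obtain \<phi> where \<phi>: "\<phi> \<in> borel_measurable borel"
    "\<And>x y. x \<le> y \<Longrightarrow> (\<phi> has_integral (h y - h x)) {x..y}"
    using abs_cont_on_has_integral[OF ac] unfolding hm by blast
  show thesis by (rule that[OF \<phi>]) (use indefinite_integral_has_vector_derivative_ae[OF \<phi>(2)] in auto)
qed

section \<open>Energy identities and discrete energy\<close>

text \<open>The energy as a function of a density; \<open>vector_derivative\<close> in
  \<open>CM_energy\<close> has an unspecified value wherever the derivative fails to exist.\<close>

definition L2_energy :: "(real \<Rightarrow> 'a::euclidean_space) \<Rightarrow> ennreal" where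
  "L2_energy \<phi> = (\<integral>\<^sup>+ t\<in>{0..}. ennreal ((norm (\<phi> t))\<^sup>2) \<partial>lborel)"

text \<open>The derivative within the half-line is unique at every \<open>t \<ge> 0\<close>,
  including the endpoint, because \<open>at t within {0..}\<close> is nontrivial; so it equals
  \<open>\<phi> t\<close> almost everywhere. A Borel integrand has the same integral over the
  completion.\<close>

lemma CM_energy_eq_L2_energy:
  fixes h :: "real \<Rightarrow> real^'n"
  assumes [measurable]: "\<phi> \<in> borel_measurable borel"
    and h: "AE t in lebesgue. (h has_vector_derivative \<phi> t) (at t)"
  shows "CM_energy h = L2_energy \<phi>"
proof -
  have "CM_energy h = (\<integral>\<^sup>+ t\<in>{0..}. ennreal ((norm (\<phi> t))\<^sup>2) \<partial>lebesgue)"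
    unfolding CM_energy_def
  proof (rule nn_integral_cong_AE, use h in eventually_elim)
    fix t assume d: "(h has_vector_derivative \<phi> t) (at t)"
    show "ennreal ((norm (vector_derivative h (at t within {0..})))\<^sup>2) * indicator {0..} t
        = ennreal ((norm (\<phi> t))\<^sup>2) * indicator {0..} t"
    proof (cases "0 \<le> t")
      case True
      have "at_right t \<le> at t within {0..}" using True by (intro at_le) auto
      then have "at t within {0..} \<noteq> bot" using trivial_limit_at_right_real[of t] bot_unique by metis
      then have "vector_derivative h (at t within {0..}) = \<phi> t"
        using has_vector_derivative_at_within[OF d] by (rule vector_derivative_within)
      then show ?thesis by simp
    qed auto
  qed
  also have "\<dots> = L2_energy \<phi>" unfolding L2_energy_def by (rule nn_integral_completion) measurable
  finally show ?thesis .
qed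

text \<open>The pointwise identity for squared norms in an inner product space, integrated. Sums
  stand on both sides because subtraction in \<open>ennreal\<close> does not undo addition at
  infinity.\<close>

lemma L2_energy_convex_combination:
  fixes \<phi> \<psi> :: "real \<Rightarrow> 'a::euclidean_space"
  assumes [measurable]: "\<phi> \<in> borel_measurable borel" "\<psi> \<in> borel_measurable borel"
    and l: "0 < l1" "0 < l2" "l1 + l2 = 1"
  shows "L2_energy (\<lambda>t. l1 *\<^sub>R \<phi> t + l2 *\<^sub>R \<psi> t) + ennreal (l1 * l2) * L2_energy (\<lambda>t. \<phi> t - \<psi> t)
       = ennreal l1 * L2_energy \<phi> + ennreal l2 * L2_energy \<psi>"
proof -
  have pw: "(norm (l1 *\<^sub>R x + l2 *\<^sub>R y))\<^sup>2 + l1 * l2 * (norm (x - y))\<^sup>2 = l1 * (norm x)\<^sup>2 + l2 * (norm y)\<^sup>2" for x y :: 'a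
  proof -
    have l2: "l2 = 1 - l1" using l by simp
    show ?thesis unfolding power2_norm_eq_inner l2
      by (simp add: inner_add_left inner_add_right inner_diff_left inner_diff_right inner_commute[of y x] algebra_simps power2_eq_square)
  qed
  have "L2_energy (\<lambda>t. l1 *\<^sub>R \<phi> t + l2 *\<^sub>R \<psi> t) + ennreal (l1 * l2) * L2_energy (\<lambda>t. \<phi> t - \<psi> t)
     = (\<integral>\<^sup>+ t. ennreal ((norm (l1 *\<^sub>R \<phi> t + l2 *\<^sub>R \<psi> t))\<^sup>2) * indicator {0..} t
          + ennreal (l1 * l2) * (ennreal ((norm (\<phi> t - \<psi> t))\<^sup>2) * indicator {0..} t) \<partial>lborel)"
    unfolding L2_energy_def by (simp add: nn_integral_add nn_integral_cmult)
  also have "\<dots> = (\<integral>\<^sup>+ t. ennreal l1 * (ennreal ((norm (\<phi> t))\<^sup>2) * indicator {0..} t)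
          + ennreal l2 * (ennreal ((norm (\<psi> t))\<^sup>2) * indicator {0..} t) \<partial>lborel)"
    using pw l by (intro nn_integral_cong) (auto simp: indicator_def simp flip: ennreal_mult ennreal_plus)
  also have "\<dots> = ennreal l1 * L2_energy \<phi> + ennreal l2 * L2_energy \<psi>"
    unfolding L2_energy_def by (simp add: nn_integral_add nn_integral_cmult)
  finally show ?thesis .
qed

lemma sq_increment_le_integral:
  fixes \<phi> :: "real \<Rightarrow> 'a::euclidean_space"
  assumes "(\<phi> has_integral D) {a..b}" "(\<lambda>t. (norm (\<phi> t))\<^sup>2) integrable_on {a..b}" "a < b"
  shows "(norm D)\<^sup>2 / (b - a) \<le> integral {a..b} (\<lambda>t. (norm (\<phi> t))\<^sup>2)"
proof -
  \<comment> \<open>Integrate \<open>0 \<le> (norm (\<phi> t - m))\<^sup>2\<close>, where \<open>m\<close> is the mean of \<open>\<phi>\<close>.\<close>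
  define m where "m = D /\<^sub>R (b - a)"
  have "((\<lambda>t. \<phi> t \<bullet> m) has_integral (D \<bullet> m)) {a..b}"
    using has_integral_linear[OF assms(1) bounded_linear_inner_left[of m]] by (simp add: o_def)
  then have "((\<lambda>t. (norm (\<phi> t))\<^sup>2 - 2 * (\<phi> t \<bullet> m) + m \<bullet> m) has_integral
      (integral {a..b} (\<lambda>t. (norm (\<phi> t))\<^sup>2) - 2 * (D \<bullet> m) + (b - a) * (m \<bullet> m))) {a..b}"
    using assms has_integral_const_real[of "m \<bullet> m" a b]
    by (intro has_integral_add has_integral_diff integrable_integral has_integral_mult_right) auto
  moreover have "0 \<le> (norm (\<phi> t))\<^sup>2 - 2 * (\<phi> t \<bullet> m) + m \<bullet> m" for t
    using inner_ge_zero[of "\<phi> t - m"]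
    by (simp add: power2_norm_eq_inner inner_diff_left inner_diff_right inner_commute)
  ultimately have "0 \<le> integral {a..b} (\<lambda>t. (norm (\<phi> t))\<^sup>2) - 2 * (D \<bullet> m) + (b - a) * (m \<bullet> m)"
    by (rule has_integral_nonneg)
  also have "\<dots> = integral {a..b} (\<lambda>t. (norm (\<phi> t))\<^sup>2) - (norm D)\<^sup>2 / (b - a)"
  proof -
    have "D \<bullet> m = (D \<bullet> D) / (b - a)" by (simp add: m_def divide_inverse mult.commute)
    moreover have "(b - a) * (m \<bullet> m) = (D \<bullet> D) / (b - a)"
      using assms(3) by (simp add: m_def divide_inverse)
    ultimately show ?thesis by (simp add: power2_norm_eq_inner)
  qed
  finally show ?thesis by simp
qed

text \<open>The left side is the energy of the piecewise linear interpolation of \<open>g\<close> on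
  the first \<open>k\<close> cells of mesh \<open>\<delta>\<close>. Each cell is bounded by the
  energy of \<open>\<phi>\<close> on it, so the bound depends neither on \<open>k\<close> nor on
  \<open>\<delta>\<close>.\<close>

lemma sum_sq_increments_le_L2_energy:
  fixes \<phi> :: "real \<Rightarrow> 'a::euclidean_space"
  assumes [measurable]: "\<phi> \<in> borel_measurable borel" and fin: "L2_energy \<phi> < \<infinity>"
    and g: "\<And>x y. x \<le> y \<Longrightarrow> (\<phi> has_integral (g y - g x)) {x..y}" and d: "0 < \<delta>"
  shows "(\<Sum>i<k. (norm (g (real (Suc i) * \<delta>) - g (real i * \<delta>)))\<^sup>2 / \<delta>) \<le> enn2real (L2_energy \<phi>)"
proof -
  define q where "q = (\<lambda>t. (norm (\<phi> t))\<^sup>2)"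
  have qE: "ennreal (q t * indicator {0..} t) = ennreal ((norm (\<phi> t))\<^sup>2) * indicator {0..} t" for t :: real
    by (simp add: q_def indicator_def)
  have E: "L2_energy \<phi> = (\<integral>\<^sup>+ t. ennreal (q t * indicator {0..} t) \<partial>lborel)"
    by (simp add: L2_energy_def qE)
  have qb: "(\<lambda>t. q t * indicator {0..} t) \<in> borel_measurable borel" unfolding q_def by measurable
  have r: "(\<lambda>t. q t * indicator {0..} t) = (\<lambda>t. if t \<in> {0..} then q t else 0)"
    by (auto simp: indicator_def)
  have "(\<lambda>t. q t * indicator {0..} t) integrable_on UNIV"
    using qb fin by (intro nn_integral_integrable_on) (auto simp: E q_def)
  then have qi: "q integrable_on {0..}" unfolding r by (simp only: integrable_restrict_UNIV)
  have "L2_energy \<phi> = ennreal (integral UNIV (\<lambda>t. q t * indicator {0..} t))"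
    unfolding E using qb fin by (intro nn_integral_lborel_eq_integral) (auto simp: E q_def)
  then have E': "L2_energy \<phi> = ennreal (integral {0..} q)"
    unfolding r by (simp only: integral_restrict_UNIV)
  have nn: "0 \<le> integral {0..} q" by (rule integral_nonneg[OF qi]) (simp add: q_def)
  have sub: "q integrable_on {a..b}" if "0 \<le> a" for a b
    using integrable_on_subinterval[OF qi, of a b] that by auto
  have "(\<Sum>i<k. (norm (g (real (Suc i) * \<delta>) - g (real i * \<delta>)))\<^sup>2 / \<delta>) \<le> integral {0..real k * \<delta>} q"
  proof (induction k)
    case (Suc k)
    have le: "0 \<le> real k * \<delta>" "real k * \<delta> < real (Suc k) * \<delta>" using d by auto
    have "(norm (g (real (Suc k) * \<delta>) - g (real k * \<delta>)))\<^sup>2 / (real (Suc k) * \<delta> - real k * \<delta>)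
       \<le> integral {real k * \<delta>..real (Suc k) * \<delta>} q"
      unfolding q_def using le sub[of "real k * \<delta>" "real (Suc k) * \<delta>"]
      by (intro sq_increment_le_integral g) (auto simp: q_def)
    moreover have "real (Suc k) * \<delta> - real k * \<delta> = \<delta>" by (simp add: algebra_simps)
    moreover have "integral {0..real k * \<delta>} q + integral {real k * \<delta>..real (Suc k) * \<delta>} q = integral {0..real (Suc k) * \<delta>} q"
      using le by (intro Henstock_Kurzweil_Integration.integral_combine sub) auto
    ultimately show ?case using Suc.IH by simp
  qed simp
  also have "\<dots> \<le> integral {0..} q"
    by (intro integral_subset_le sub qi) (auto simp: q_def)
  also have "\<dots> = enn2real (L2_energy \<phi>)" using nn by (simp add: E')
  finally show ?thesis .
qed

text \<open>\<open>K\<close> is the energy of \<open>h1 - h2\<close>, read off from the difference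
  of the two densities. The exact identity accounts for the quadratic terms in \<open>Phi\<close>;
  the bound on every uniform grid makes the finite-dimensional estimates uniform.\<close>

lemma CM_convex_combination:
  fixes h1 h2 :: "real \<Rightarrow> real^'n"
  assumes h: "h1 \<in> CM" "h2 \<in> CM" and l: "0 < l1" "0 < l2" "l1 + l2 = 1"
  obtains K where
    "CM_norm_sq (\<lambda>t. l1 *\<^sub>R h1 t + l2 *\<^sub>R h2 t) + l1 * l2 * K = l1 * CM_norm_sq h1 + l2 * CM_norm_sq h2"
    "\<And>\<delta> k. 0 < \<delta> \<Longrightarrow> (\<Sum>i<k. (norm ((h1 (real (Suc i) * \<delta>) - h2 (real (Suc i) * \<delta>))
        - (h1 (real i * \<delta>) - h2 (real i * \<delta>))))\<^sup>2 / \<delta>) \<le> K"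
proof -
  obtain \<phi> where \<phi>[measurable]: "\<phi> \<in> borel_measurable borel"
    "\<And>x y. x \<le> y \<Longrightarrow> (\<phi> has_integral (h1 y - h1 x)) {x..y}"
    "AE t in lebesgue. (h1 has_vector_derivative \<phi> t) (at t)"
    using CM_has_density[OF h(1)] by blast
  obtain \<psi> where \<psi>[measurable]: "\<psi> \<in> borel_measurable borel"
    "\<And>x y. x \<le> y \<Longrightarrow> (\<psi> has_integral (h2 y - h2 x)) {x..y}"
    "AE t in lebesgue. (h2 has_vector_derivative \<psi> t) (at t)"
    using CM_has_density[OF h(2)] by blast
  have e1: "CM_energy h1 = L2_energy \<phi>" by (rule CM_energy_eq_L2_energy[OF \<phi>(1,3)])
  have e2: "CM_energy h2 = L2_energy \<psi>" by (rule CM_energy_eq_L2_energy[OF \<psi>(1,3)])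
  have e: "CM_energy (\<lambda>t. l1 *\<^sub>R h1 t + l2 *\<^sub>R h2 t) = L2_energy (\<lambda>t. l1 *\<^sub>R \<phi> t + l2 *\<^sub>R \<psi> t)"
  proof (rule CM_energy_eq_L2_energy)
    show "AE t in lebesgue. ((\<lambda>t. l1 *\<^sub>R h1 t + l2 *\<^sub>R h2 t) has_vector_derivative l1 *\<^sub>R \<phi> t + l2 *\<^sub>R \<psi> t) (at t)"
      using \<phi>(3) \<psi>(3)
    proof eventually_elim
      case (elim t)
      then show ?case
        by (intro has_vector_derivative_add bounded_linear.has_vector_derivative[OF bounded_linear_scaleR_right])
    qed
  qed measurable
  have fin: "L2_energy \<phi> < \<infinity>" "L2_energy \<psi> < \<infinity>"
    using h e1 e2 by (auto simp: CM_def)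
  let ?E = "L2_energy (\<lambda>t. l1 *\<^sub>R \<phi> t + l2 *\<^sub>R \<psi> t)" and ?D = "L2_energy (\<lambda>t. \<phi> t - \<psi> t)"
  have id: "?E + ennreal (l1 * l2) * ?D = ennreal l1 * L2_energy \<phi> + ennreal l2 * L2_energy \<psi>"
    by (rule L2_energy_convex_combination) (use l in auto)
  also have rhs: "ennreal l1 * L2_energy \<phi> + ennreal l2 * L2_energy \<psi> < \<infinity>"
    using fin by (simp add: ennreal_mult_less_top)
  \<comment> \<open>All terms are finite, \<open>?D\<close> because \<open>l1 * l2\<close> is
    positive, so \<open>enn2real\<close> distributes over the identity.\<close>
  finally have f2: "?E < \<infinity>" "ennreal (l1 * l2) * ?D < \<infinity>" by auto
  have f3: "?D < \<infinity>" using f2(2) l by (auto simp: ennreal_mult_less_top)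
  show thesis
  proof (rule that[of "enn2real ?D"])
    have "enn2real (?E + ennreal (l1 * l2) * ?D) = enn2real ?E + l1 * l2 * enn2real ?D"
      using f2 l by (subst enn2real_plus) (auto simp: enn2real_mult)
    moreover have "enn2real (ennreal l1 * L2_energy \<phi> + ennreal l2 * L2_energy \<psi>)
        = l1 * enn2real (L2_energy \<phi>) + l2 * enn2real (L2_energy \<psi>)"
      using rhs l by (subst enn2real_plus) (auto simp: enn2real_mult)
    ultimately show "CM_norm_sq (\<lambda>t. l1 *\<^sub>R h1 t + l2 *\<^sub>R h2 t) + l1 * l2 * enn2real ?D
        = l1 * CM_norm_sq h1 + l2 * CM_norm_sq h2"
      unfolding CM_norm_sq_def e e1 e2 using id by simp
    fix \<delta> :: real and k :: nat assume "0 < \<delta>"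
    show "(\<Sum>i<k. (norm ((h1 (real (Suc i) * \<delta>) - h2 (real (Suc i) * \<delta>))
        - (h1 (real i * \<delta>) - h2 (real i * \<delta>))))\<^sup>2 / \<delta>) \<le> enn2real ?D"
    proof (rule sum_sq_increments_le_L2_energy[where g="\<lambda>t. h1 t - h2 t", OF _ f3 _ \<open>0 < \<delta>\<close>])
      fix x y :: real assume "x \<le> y"
      from has_integral_diff[OF \<phi>(2)[OF this] \<psi>(2)[OF this]]
      show "((\<lambda>t. \<phi> t - \<psi> t) has_integral (h1 y - h2 y - (h1 x - h2 x))) {x..y}"
        by (simp add: algebra_simps)
    qed measurable
  qed
qed

section \<open>Comparison of measures on a generating algebra\<close>

text \<open>Sets approximable from the algebra are closed under complements and countable unions.
  One approximating set serves all measures of the finite family at once, since it will be used to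
  compare them.\<close>

lemma sigma_sets_approx_by_algebra:
  fixes M :: "'i \<Rightarrow> 'a measure"
  assumes alg: "algebra \<Omega> A" and I: "finite I"
    and fin: "\<And>i. i \<in> I \<Longrightarrow> finite_measure (M i)"
    and sets: "\<And>i. i \<in> I \<Longrightarrow> sets (M i) = sigma_sets \<Omega> A"
    and X: "X \<in> sigma_sets \<Omega> A" and e: "0 < e"
  shows "\<exists>a\<in>A. \<forall>i\<in>I. measure (M i) (sym_diff X a) < e"
  using X e
proof (induction arbitrary: e rule: sigma_sets.induct)
  case (Basic a)
  then show ?case by (intro bexI[of _ a]) auto
next
  case Empty
  interpret algebra \<Omega> A by fact
  show ?case using Empty by (intro bexI[of _ "{}"]) auto
next
  case (Compl X)
  interpret algebra \<Omega> A by fact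
  obtain a where a: "a \<in> A" "\<forall>i\<in>I. measure (M i) (sym_diff X a) < e" using Compl by blast
  have "X \<subseteq> \<Omega>" "a \<subseteq> \<Omega>"
    using sigma_sets_into_sp[OF space_closed Compl.hyps] a(1) space_closed by auto
  then have "sym_diff (\<Omega> - X) (\<Omega> - a) = sym_diff X a" by auto
  then show ?case using a by (intro bexI[of _ "\<Omega> - a"]) auto
next
  case (Union X)
  interpret algebra \<Omega> A by fact
  have Xs: "X k \<in> sets (M i)" if "i \<in> I" for i k using Union.hyps sets[OF that] by simp
  have As: "a \<in> sets (M i)" if "i \<in> I" "a \<in> A" for i a using that sets[of i] by auto
  \<comment> \<open>By finiteness of the measures the tail of the union is small beyond some
    \<open>n\<close> common to the finite family; only the first \<open>n\<close> sets are then
    approximated.\<close>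
  have "\<forall>\<^sub>F n in sequentially. measure (M i) ((\<Union>k. X k) - (\<Union>k<n. X k)) < e / 2" if i: "i \<in> I" for i
  proof -
    interpret finite_measure "M i" using fin i .
    have "(\<lambda>n. measure (M i) ((\<Union>k. X k) - (\<Union>k<n. X k))) \<longlonglongrightarrow>
        measure (M i) (\<Inter>n. (\<Union>k. X k) - (\<Union>k<n. X k))"
      by (intro finite_Lim_measure_decseq) (auto simp: decseq_def intro!: sets.Diff sets.countable_UN Xs[OF i])
    also have "(\<Inter>n. (\<Union>k. X k) - (\<Union>k<n. X k)) = {}" by auto
    finally show ?thesis using Union.prems by (intro order_tendstoD(2)[of _ 0]) auto
  qed
  then have "\<forall>\<^sub>F n in sequentially. \<forall>i\<in>I. measure (M i) ((\<Union>k. X k) - (\<Union>k<n. X k)) < e / 2"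
    using I by (simp add: eventually_ball_finite_distrib)
  then obtain n where n: "\<forall>i\<in>I. measure (M i) ((\<Union>k. X k) - (\<Union>k<n. X k)) < e / 2"
    by (auto simp: eventually_sequentially)
  have e': "0 < e / 2 / (real n + 1)" using Union.prems by simp
  obtain a where a: "\<And>k. a k \<in> A" "\<And>k i. i \<in> I \<Longrightarrow> measure (M i) (sym_diff (X k) (a k)) < e / 2 / (real n + 1)"
    using Union.IH[OF e'] by metis
  show ?case
  proof (intro bexI[of _ "\<Union>k<n. a k"] ballI)
    show "(\<Union>k<n. a k) \<in> A" using a by (intro finite_UN) auto
    fix i assume i: "i \<in> I"
    interpret finite_measure "M i" using fin i .
    have m[measurable]: "X k \<in> sets (M i)" "a k \<in> sets (M i)" for k using Xs As a i by auto
    have "measure (M i) (sym_diff (\<Union>k. X k) (\<Union>k<n. a k))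
        \<le> measure (M i) (((\<Union>k. X k) - (\<Union>k<n. X k)) \<union> (\<Union>k<n. sym_diff (X k) (a k)))"
      by (intro finite_measure_mono) (auto, measurable)
    also have "\<dots> \<le> measure (M i) ((\<Union>k. X k) - (\<Union>k<n. X k)) + measure (M i) (\<Union>k<n. sym_diff (X k) (a k))"
      by (intro measure_Un_le) measurable
    also have "measure (M i) (\<Union>k<n. sym_diff (X k) (a k)) \<le> (\<Sum>k<n. measure (M i) (sym_diff (X k) (a k)))"
      by (intro measure_UNION_le) auto
    also have "\<dots> \<le> (\<Sum>k<n. e / 2 / (real n + 1))"
      using a(2)[OF i] by (intro sum_mono less_imp_le) auto
    also have "\<dots> \<le> e / 2" using Union.prems by (simp add: field_simps)
    finally show "measure (M i) (sym_diff (\<Union>k. X k) (\<Union>k<n. a k)) < e" using n i by fastforce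
  qed
qed

lemma (in finite_measure) abs_measure_diff_le:
  assumes [measurable]: "A \<in> sets M" "B \<in> sets M"
  shows "\<bar>measure M A - measure M B\<bar> \<le> measure M (sym_diff A B)"
proof -
  have "measure M A \<le> measure M (B \<union> sym_diff A B)" "measure M B \<le> measure M (A \<union> sym_diff A B)"
    by (auto intro!: finite_measure_mono)
  moreover have "measure M (B \<union> sym_diff A B) \<le> measure M B + measure M (sym_diff A B)"
    "measure M (A \<union> sym_diff A B) \<le> measure M A + measure M (sym_diff A B)"
    by (auto intro!: measure_Un_le)
  ultimately show ?thesis by linarith
qed

lemma measure_le_linear_combination_from_algebra:
  assumes alg: "algebra \<Omega> A" and c: "0 \<le> c1" "0 \<le> c2"
    and fin: "finite_measure M" "finite_measure M1" "finite_measure M2"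
    and sets: "sets M = sigma_sets \<Omega> A" "sets M1 = sigma_sets \<Omega> A" "sets M2 = sigma_sets \<Omega> A"
    and le: "\<And>a. a \<in> A \<Longrightarrow> measure M a \<le> c1 * measure M1 a + c2 * measure M2 a"
    and X: "X \<in> sets M"
  shows "measure M X \<le> c1 * measure M1 X + c2 * measure M2 X"
proof (rule field_le_epsilon)
  fix e :: real assume e: "0 < e"
  interpret M: finite_measure M by fact
  interpret M1: finite_measure M1 by fact
  interpret M2: finite_measure M2 by fact
  \<comment> \<open>Replacing \<open>X\<close> by the algebra set \<open>a\<close> costs
    \<open>d\<close> for \<open>M\<close> and \<open>c1 * d + c2 * d\<close> on the other side,
    which add up to \<open>e\<close>.\<close>
  define d where "d = e / (1 + c1 + c2)"
  have d: "0 < d" using e c by (simp add: d_def)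
  have "\<exists>a\<in>A. \<forall>N\<in>{M, M1, M2}. measure N (sym_diff X a) < d"
    by (rule sigma_sets_approx_by_algebra[OF alg, of _ "\<lambda>N. N"]) (use fin sets X d in auto)
  then obtain a where a: "a \<in> A" "measure M (sym_diff X a) < d" "measure M1 (sym_diff X a) < d"
      "measure M2 (sym_diff X a) < d" by auto
  have as: "a \<in> sigma_sets \<Omega> A" using a by auto
  have "\<bar>measure M X - measure M a\<bar> \<le> d" "\<bar>measure M1 X - measure M1 a\<bar> \<le> d" "\<bar>measure M2 X - measure M2 a\<bar> \<le> d"
    using M.abs_measure_diff_le[of X a] M1.abs_measure_diff_le[of X a] M2.abs_measure_diff_le[of X a] a X as sets by auto
  then have *: "measure M X \<le> measure M a + d" "measure M1 a \<le> measure M1 X + d" "measure M2 a \<le> measure M2 X + d"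
    by linarith+
  have "measure M X \<le> c1 * measure M1 a + c2 * measure M2 a + d" using *(1) le[OF a(1)] by simp
  also have "\<dots> \<le> c1 * (measure M1 X + d) + c2 * (measure M2 X + d) + d"
    using * c by (intro add_mono mult_left_mono) auto
  also have "\<dots> = c1 * measure M1 X + c2 * measure M2 X + (1 + c1 + c2) * d" by (simp add: algebra_simps)
  also have "(1 + c1 + c2) * d = e" using c by (simp add: d_def)
  finally show "measure M X \<le> c1 * measure M1 X + c2 * measure M2 X + e" .
qed

text \<open>Induction on \<open>f\<close> starting from indicators. At a supremum, monotone
  convergence is applied under \<open>M\<close> and plain monotonicity under \<open>M1\<close> and
  \<open>M2\<close>.\<close>

lemma nn_integral_le_linear_combination:
  assumes [measurable_cong]: "sets M1 = sets M" "sets M2 = sets M"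
    and le: "\<And>X. X \<in> sets M \<Longrightarrow> emeasure M X \<le> c1 * emeasure M1 X + c2 * emeasure M2 X"
    and f: "f \<in> borel_measurable M"
  shows "(\<integral>\<^sup>+x. f x \<partial>M) \<le> c1 * (\<integral>\<^sup>+x. f x \<partial>M1) + c2 * (\<integral>\<^sup>+x. f x \<partial>M2)"
  using f
proof (induction rule: borel_measurable_induct)
  case (cong f g)
  have sp: "space M1 = space M" "space M2 = space M" using assms(1,2) by (auto dest: sets_eq_imp_space_eq)
  have "integral\<^sup>N M f = integral\<^sup>N M g" "integral\<^sup>N M1 f = integral\<^sup>N M1 g" "integral\<^sup>N M2 f = integral\<^sup>N M2 g"
    using cong(3) sp by (auto intro!: nn_integral_cong)
  then show ?case using cong(4) by simp
next
  case (set A)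
  then show ?case using le[OF set] assms(1,2) by simp
next
  case (mult u c)
  note [measurable] = mult(2)
  have "c * (\<integral>\<^sup>+x. u x \<partial>M) \<le> c * (c1 * (\<integral>\<^sup>+x. u x \<partial>M1) + c2 * (\<integral>\<^sup>+x. u x \<partial>M2))"
    using mult by (intro mult_left_mono) auto
  then show ?case by (simp add: nn_integral_cmult distrib_left mult.left_commute)
next
  case (add u v)
  have [measurable]: "u \<in> borel_measurable M" "v \<in> borel_measurable M" by fact+
  have "(\<integral>\<^sup>+x. v x \<partial>M) + (\<integral>\<^sup>+x. u x \<partial>M) \<le> (c1 * (\<integral>\<^sup>+x. v x \<partial>M1) + c2 * (\<integral>\<^sup>+x. v x \<partial>M2))
      + (c1 * (\<integral>\<^sup>+x. u x \<partial>M1) + c2 * (\<integral>\<^sup>+x. u x \<partial>M2))"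
    using add by (intro add_mono) auto
  then show ?case by (simp add: nn_integral_add distrib_left ac_simps)
next
  case (seq U)
  note [measurable] = seq(1)
  have "(SUP i. U i) = (\<lambda>x. SUP i. U i x)" by (simp add: fun_eq_iff image_comp)
  then have "integral\<^sup>N M (SUP i. U i) = (SUP i. integral\<^sup>N M (U i))"
    using nn_integral_monotone_convergence_SUP[OF \<open>incseq U\<close> seq(1)] by simp
  also have "\<dots> \<le> c1 * integral\<^sup>N M1 (SUP i. U i) + c2 * integral\<^sup>N M2 (SUP i. U i)"
  proof (rule SUP_least)
    fix i
    have "integral\<^sup>N M (U i) \<le> c1 * integral\<^sup>N M1 (U i) + c2 * integral\<^sup>N M2 (U i)" by (rule seq.IH)
    also have "\<dots> \<le> c1 * integral\<^sup>N M1 (SUP i. U i) + c2 * integral\<^sup>N M2 (SUP i. U i)"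
      by (intro add_mono mult_left_mono nn_integral_mono) (auto intro: SUP_upper le_funD[OF SUP_upper])
    finally show "integral\<^sup>N M (U i) \<le> c1 * integral\<^sup>N M1 (SUP i. U i) + c2 * integral\<^sup>N M2 (SUP i. U i)" .
  qed
  finally show ?case .
qed

text \<open>Compared on rectangles, whose preimages are rectangles with translated sides; each
  factor is translation invariant.\<close>

lemma distr_PiM_lborel_translate:
  fixes v :: "'i \<Rightarrow> 'a::euclidean_space"
  assumes I: "finite I"
  shows "distr (PiM I (\<lambda>_. lborel)) (PiM I (\<lambda>_. lborel)) (\<lambda>y. \<lambda>i\<in>I. y i + v i) = PiM I (\<lambda>_. lborel)"
proof -
  interpret product_sigma_finite "\<lambda>_::'i. lborel :: 'a measure"
    by (simp add: product_sigma_finite_def sigma_finite_lborel)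
  have m[measurable]: "(\<lambda>y. \<lambda>i\<in>I. y i + v i) \<in> PiM I (\<lambda>_. lborel) \<rightarrow>\<^sub>M PiM I (\<lambda>_. lborel)"
    by (rule measurable_restrict) measurable
  show ?thesis
  proof (rule PiM_eqI[OF I])
    fix A :: "'i \<Rightarrow> 'a set" assume A: "\<And>i. i \<in> I \<Longrightarrow> A i \<in> sets lborel"
    have sh: "(\<lambda>x. x + v i) -` A i \<in> sets lborel" if "i \<in> I" for i
      using measurable_sets[of "\<lambda>x. x + v i" lborel lborel "A i"] A[OF that] by simp
    have "emeasure (distr (PiM I (\<lambda>_. lborel)) (PiM I (\<lambda>_. lborel)) (\<lambda>y. \<lambda>i\<in>I. y i + v i)) (Pi\<^sub>E I A)
        = emeasure (PiM I (\<lambda>_. lborel)) ((\<lambda>y. \<lambda>i\<in>I. y i + v i) -` Pi\<^sub>E I A \<inter> space (PiM I (\<lambda>_. lborel)))"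
      using A I by (intro emeasure_distr m sets_PiM_I_finite) auto
    also have "(\<lambda>y. \<lambda>i\<in>I. y i + v i) -` Pi\<^sub>E I A \<inter> space (PiM I (\<lambda>_. lborel)) = Pi\<^sub>E I (\<lambda>i. (\<lambda>x. x + v i) -` A i)"
      by (auto simp: space_PiM PiE_def Pi_def extensional_def restrict_def)
    also have "emeasure (PiM I (\<lambda>_. lborel)) \<dots> = (\<Prod>i\<in>I. emeasure lborel ((\<lambda>x. x + v i) -` A i))"
      using sh I by (intro emeasure_PiM) auto
    also have "\<dots> = (\<Prod>i\<in>I. emeasure lborel (A i))"
    proof (rule prod.cong[OF refl])
      fix i assume i: "i \<in> I"
      have "emeasure lborel (A i) = emeasure (distr lborel borel ((+) (v i))) (A i)"
        by (simp add: lborel_distr_plus)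
      also have "\<dots> = emeasure lborel ((\<lambda>x. x + v i) -` A i)"
        using A[OF i] by (subst emeasure_distr) (auto simp: add.commute intro!: arg_cong[where f="emeasure lborel"])
      finally show "emeasure lborel ((\<lambda>x. x + v i) -` A i) = emeasure lborel (A i)" by simp
    qed
    finally show "emeasure (distr (PiM I (\<lambda>_. lborel)) (PiM I (\<lambda>_. lborel)) (\<lambda>y. \<lambda>i\<in>I. y i + v i)) (Pi\<^sub>E I A)
      = (\<Prod>i\<in>I. emeasure lborel (A i))" .
  qed simp
qed

section \<open>The Borel sigma-algebra of path space\<close>

text \<open>Time \<open>0\<close> is omitted since paths start at the origin. With mesh
  \<open>1 / 2^n\<close> and horizon \<open>2^n\<close>, successive grids are nested, and together
  they are dense in the half-line.\<close>

definition dyadic_sample :: "nat \<Rightarrow> (real \<Rightarrow> real^'n) \<Rightarrow> nat \<Rightarrow> real^'n" where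
  "dyadic_sample n \<gamma> = (\<lambda>i\<in>{..<4^n}. \<gamma> (real (Suc i) / 2^n))"

abbreviation sample_space :: "nat \<Rightarrow> (nat \<Rightarrow> real^'n) measure" where
  "sample_space n \<equiv> PiM {..<4^n} (\<lambda>_. lborel)"

definition dyadic_cylinders :: "(real \<Rightarrow> real^'n) set set" where
  "dyadic_cylinders = (\<Union>n. sets (vimage_algebra P0 (dyadic_sample n) (sample_space n)))"

definition dyadic_times :: "real set" where
  "dyadic_times = {real (Suc j) / 2^n | n j. j < 4^n}"

lemma countable_dyadic_times: "countable dyadic_times"
proof -
  have "dyadic_times \<subseteq> (\<lambda>(n, j). real (Suc j) / 2^n) ` (UNIV :: (nat \<times> nat) set)"
    by (auto simp: dyadic_times_def)
  then show ?thesis by (rule countable_subset) simp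
qed

text \<open>The right endpoint of a dyadic cell inside the ball around \<open>t + e / 2\<close> is
  such a time. Approximating from the right works at \<open>t = 0\<close> too, though
  \<open>dyadic_times\<close> are positive.\<close>

lemma dyadic_times_dense:
  assumes "0 \<le> t" "0 < e"
  obtains q where "q \<in> dyadic_times" "t < q" "q < t + e"
proof -
  obtain n j where j: "j < 4^n" "t + e/2 \<in> dyadic_Ioc n j" "dyadic_Ioc n j \<subseteq> ball (t + e/2) (e/2)"
    by (rule ex_dyadic_Ioc[of "t + e/2" "e/2"]) (use assms in auto)
  define q where "q = real (Suc j) / 2^n"
  have "q \<in> dyadic_Ioc n j" by (auto simp: dyadic_Ioc_def q_def divide_strict_right_mono add.commute)
  then have "q \<in> ball (t + e/2) (e/2)" using j by blast
  then have "t < q" "q < t + e" by (auto simp: dist_real_def abs_if split: if_splits)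
  moreover have "q \<in> dyadic_times" using j by (auto simp: dyadic_times_def q_def)
  ultimately show thesis by (rule that[rotated])
qed

lemma dyadic_times_pos: "q \<in> dyadic_times \<Longrightarrow> 0 < q"
  by (auto simp: dyadic_times_def)

lemma openin_compact_open_subset:
  fixes S :: "(real \<Rightarrow> real^'n) set"
  assumes S: "openin compact_open_P0 S"
  shows "S \<subseteq> P0"
proof -
  have "topspace compact_open_P0 \<subseteq> (P0 :: (real \<Rightarrow> real^'n) set)"
    unfolding compact_open_P0_def topology_generated_by_topspace by (rule Union_least) auto
  then show ?thesis using openin_subset[OF S] by (rule order_trans[rotated])
qed

lemma space_borel_P0 [simp]: "space borel_P0 = P0"
  unfolding borel_P0_def by (rule space_measure_of) (auto dest: openin_compact_open_subset)

lemma sets_borel_P0: "sets borel_P0 = sigma_sets P0 {S. openin compact_open_P0 S}"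
  unfolding borel_P0_def by (rule sets_measure_of) (auto dest: openin_compact_open_subset)

text \<open>For \<open>t \<ge> 0\<close> the singleton \<open>{t}\<close> is compact, so preimages
  of open sets are subbasic; on the negative axis evaluation is constantly \<open>0\<close>.\<close>

lemma eval_measurable_borel_P0: "(\<lambda>\<gamma>. \<gamma> t) \<in> borel_measurable (borel_P0 :: (real \<Rightarrow> real^'n) measure)"
proof (cases "0 \<le> t")
  case True
  show ?thesis
  proof (rule borel_measurableI)
    fix U :: "(real^'n) set" assume U: "open U"
    have "openin compact_open_P0 {\<gamma>\<in>P0. \<gamma> ` {t} \<subseteq> U}"
      unfolding compact_open_P0_def openin_topology_generated_by_iff
    proof (rule generate_topology_on.Basis, rule CollectI, intro exI conjI)
      show "{\<gamma>\<in>P0. \<gamma> ` {t} \<subseteq> U} = {\<gamma>\<in>P0. \<gamma> ` {t} \<subseteq> U}" ..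
    qed (use U True in auto)
    moreover have "{\<gamma>\<in>P0. \<gamma> ` {t} \<subseteq> U} = (\<lambda>\<gamma>. \<gamma> t) -` U \<inter> space borel_P0" by auto
    ultimately show "(\<lambda>\<gamma>. \<gamma> t) -` U \<inter> space borel_P0 \<in> sets borel_P0"
      unfolding sets_borel_P0 by auto
  qed
next
  case False
  have "(\<lambda>\<gamma>. \<gamma> t) \<in> borel_measurable (borel_P0 :: (real \<Rightarrow> real^'n) measure) \<longleftrightarrow>
      (\<lambda>\<gamma>. 0 :: real^'n) \<in> borel_measurable (borel_P0 :: (real \<Rightarrow> real^'n) measure)"
    by (rule measurable_cong) (use False in \<open>auto simp: P0_def\<close>)
  then show ?thesis by simp
qed

lemma dyadic_sample_in_space: "dyadic_sample n \<in> X \<rightarrow> space (sample_space n)"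
  by (auto simp: dyadic_sample_def space_PiM)

lemma dyadic_sample_measurable:
  assumes "\<And>j. j < 4^n \<Longrightarrow> (\<lambda>\<gamma>. \<gamma> (real (Suc j) / 2^n)) \<in> borel_measurable M"
  shows "dyadic_sample n \<in> M \<rightarrow>\<^sub>M sample_space n"
proof -
  have "(\<lambda>\<gamma>. \<lambda>i\<in>{..<4^n}. \<gamma> (real (Suc i) / 2^n)) \<in> M \<rightarrow>\<^sub>M sample_space n"
    by (rule measurable_restrict) (use assms in auto)
  then show ?thesis by (simp add: dyadic_sample_def[abs_def])
qed

lemma dyadic_sample_measurable_borel_P0:
  "dyadic_sample n \<in> (borel_P0 :: (real \<Rightarrow> real^'n) measure) \<rightarrow>\<^sub>M sample_space n"
  by (intro dyadic_sample_measurable eval_measurable_borel_P0)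

lemma sets_dyadic_sample:
  "sets (vimage_algebra P0 (dyadic_sample n) (sample_space n)) = {dyadic_sample n -` B \<inter> P0 | B. B \<in> sets (sample_space n)}"
  by (rule sets_vimage_algebra2[OF dyadic_sample_in_space])

text \<open>Point \<open>i\<close> of the coarse grid is point \<open>2 * i + 1\<close> of the fine
  one, so the coarse sample is a measurable function of the fine sample.\<close>

lemma dyadic_cylinders_Suc:
  "sets (vimage_algebra P0 (dyadic_sample n) (sample_space n :: (nat \<Rightarrow> real^'n) measure))
     \<subseteq> sets (vimage_algebra P0 (dyadic_sample (Suc n)) (sample_space (Suc n)))"
proof -
  let ?g = "\<lambda>y::nat \<Rightarrow> real^'n. \<lambda>i\<in>{..<4^n}. y (2*i+1)"
  have g: "?g \<in> sample_space (Suc n) \<rightarrow>\<^sub>M sample_space n"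
  proof (rule measurable_restrict)
    fix i :: nat assume "i \<in> {..<4^n}"
    then have "2*i+1 \<in> {..<4^Suc n}" by auto
    then show "(\<lambda>y. y (2*i+1)) \<in> sample_space (Suc n) \<rightarrow>\<^sub>M lborel" by (rule measurable_component_singleton)
  qed
  have eq: "dyadic_sample n \<gamma> = ?g (dyadic_sample (Suc n) \<gamma>)" for \<gamma> :: "real \<Rightarrow> real^'n"
  proof
    fix i
    have "real (Suc (2*i+1)) / 2^Suc n = real (Suc i) / 2^n" by (simp add: field_simps)
    moreover have "i < 4^n \<Longrightarrow> 2*i+1 < 4^Suc n" by simp
    ultimately show "dyadic_sample n \<gamma> i = ?g (dyadic_sample (Suc n) \<gamma>) i"
      by (auto simp: dyadic_sample_def simp del: of_nat_Suc power_Suc)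
  qed
  show ?thesis
  proof
    fix S :: "(real \<Rightarrow> real^'n) set"
    assume "S \<in> sets (vimage_algebra P0 (dyadic_sample n) (sample_space n))"
    then obtain B where B: "B \<in> sets (sample_space n)" "S = dyadic_sample n -` B \<inter> P0"
      unfolding sets_dyadic_sample by blast
    have "S = dyadic_sample (Suc n) -` (?g -` B \<inter> space (sample_space (Suc n))) \<inter> P0"
      using dyadic_sample_in_space[of "Suc n" UNIV] unfolding B(2) by (auto simp: eq simp del: power_Suc)
    moreover have "?g -` B \<inter> space (sample_space (Suc n)) \<in> sets (sample_space (Suc n))"
      by (rule measurable_sets[OF g B(1)])
    ultimately show "S \<in> sets (vimage_algebra P0 (dyadic_sample (Suc n)) (sample_space (Suc n)))"
      unfolding sets_dyadic_sample by blast
  qed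
qed

text \<open>The sigma-algebras attached to the grids increase with the level, so any two cylinder
  sets lie in a common one.\<close>

lemma algebra_dyadic_cylinders: "algebra P0 (dyadic_cylinders :: (real \<Rightarrow> real^'n) set set)"
proof -
  let ?F = "\<lambda>n. sets (vimage_algebra P0 (dyadic_sample n) (sample_space n :: (nat \<Rightarrow> real^'n) measure))"
  have inc: "?F m \<subseteq> ?F n" if "m \<le> n" for m n
    using lift_Suc_mono_le[of ?F, OF dyadic_cylinders_Suc that] .
  show ?thesis unfolding algebra_iff_Un
  proof (intro conjI ballI)
    show "dyadic_cylinders \<subseteq> Pow (P0 :: (real \<Rightarrow> real^'n) set)"
      unfolding dyadic_cylinders_def using sets.sets_into_space by fastforce
    show "{} \<in> dyadic_cylinders" by (auto simp: dyadic_cylinders_def)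
    fix a :: "(real \<Rightarrow> real^'n) set" assume "a \<in> dyadic_cylinders"
    then obtain m where a: "a \<in> ?F m" by (auto simp: dyadic_cylinders_def)
    show "P0 - a \<in> dyadic_cylinders"
      using sets.compl_sets[OF a] by (auto simp: dyadic_cylinders_def)
    fix b :: "(real \<Rightarrow> real^'n) set" assume "b \<in> dyadic_cylinders"
    then obtain n where b: "b \<in> ?F n" by (auto simp: dyadic_cylinders_def)
    have "a \<in> ?F (max m n)" "b \<in> ?F (max m n)" using a b inc[of m "max m n"] inc[of n "max m n"] by auto
    then have "a \<union> b \<in> ?F (max m n)" by (rule sets.Un)
    then show "a \<union> b \<in> dyadic_cylinders" unfolding dyadic_cylinders_def by blast
  qed
qed

lemmas dyadic_cylinders_subset = algebra_dyadic_cylinders[unfolded algebra_iff_Un, THEN conjunct1]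

text \<open>These sets are not open, but every open set is a countable union of finite intersections of them
  with rational parameters and centres in a countable dense set.\<close>
definition dyadic_box :: "real \<Rightarrow> real \<Rightarrow> real^'n \<Rightarrow> real \<Rightarrow> (real \<Rightarrow> real^'n) set" where
  "dyadic_box a b c r = {\<gamma>\<in>P0. \<forall>q\<in>dyadic_times. a < q \<and> q < b \<longrightarrow> \<gamma> q \<in> cball c r}"

text \<open>By continuity and density of the dyadic times, a constraint at those times extends to
  all times in the open window; closedness of the ball is what survives the limit.\<close>

lemma dyadic_box_imp_cball:
  assumes \<gamma>: "\<gamma> \<in> dyadic_box a b c r" and t: "0 \<le> t" "a < t" "t < b"
  shows "\<gamma> t \<in> cball c r"
proof (rule ccontr)
  assume n: "\<gamma> t \<notin> cball c r"
  have c: "continuous_on {0..} \<gamma>" using \<gamma> by (auto simp: dyadic_box_def P0_def)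
  define e where "e = dist c (\<gamma> t) - r"
  have e: "0 < e" using n by (simp add: e_def)
  obtain d where d: "0 < d" "\<And>s. 0 \<le> s \<Longrightarrow> dist s t < d \<Longrightarrow> dist (\<gamma> s) (\<gamma> t) < e"
    using c t(1) e unfolding continuous_on_iff by (metis atLeast_iff)
  obtain q where q: "q \<in> dyadic_times" "t < q" "q < t + min d (b - t)"
    using dyadic_times_dense[OF t(1), of "min d (b - t)"] d t by auto
  have "dist (\<gamma> q) (\<gamma> t) < e" using d(2)[of q] q t by (auto simp: dist_real_def)
  moreover have "dist c (\<gamma> q) \<le> r" using \<gamma> q t by (auto simp: dyadic_box_def)
  moreover have "dist c (\<gamma> t) \<le> dist c (\<gamma> q) + dist (\<gamma> q) (\<gamma> t)" by (rule dist_triangle)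
  ultimately show False by (simp add: e_def)
qed

lemma ex_dyadic_box:
  fixes \<gamma> :: "real \<Rightarrow> real^'n"
  assumes \<gamma>: "\<gamma> \<in> P0" and t: "0 \<le> t" and U: "open U" "\<gamma> t \<in> U"
    and D: "\<And>X. open X \<Longrightarrow> X \<noteq> {} \<Longrightarrow> \<exists>d\<in>D. d \<in> X"
  obtains a b c r where "a \<in> \<rat>" "b \<in> \<rat>" "c \<in> D" "r \<in> \<rat>" "a < t" "t < b"
    "\<gamma> \<in> dyadic_box a b c r" "cball c r \<subseteq> U"
proof -
  obtain e where e: "0 < e" "ball (\<gamma> t) e \<subseteq> U" using U open_contains_ball by blast
  obtain c where c: "c \<in> D" "dist (\<gamma> t) c < e/4"
    using D[of "ball (\<gamma> t) (e/4)"] e by auto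
  \<comment> \<open>With \<open>dist (\<gamma> t) c < e / 4\<close>, the bound
    \<open>r < e / 2\<close> keeps the closed ball inside \<open>ball (\<gamma> t) e\<close>, and
    \<open>r > e / 4\<close> leaves the margin \<open>r - e / 4\<close> for the motion of
    \<open>\<gamma>\<close> near \<open>t\<close>.\<close>
  obtain r where r: "r \<in> \<rat>" "e/4 < r" "r < e/2"
    using Rats_dense_in_real[of "e/4" "e/2"] e by auto
  have sub: "cball c r \<subseteq> U"
  proof
    fix x assume "x \<in> cball c r"
    then have "dist (\<gamma> t) x < e" using c(2) r dist_triangle[of "\<gamma> t" x c] e by auto
    then show "x \<in> U" using e by auto
  qed
  have cont: "continuous_on {0..} \<gamma>" using \<gamma> by (auto simp: P0_def)
  obtain d where d: "0 < d" "\<And>s. 0 \<le> s \<Longrightarrow> dist s t < d \<Longrightarrow> dist (\<gamma> s) (\<gamma> t) < r - e/4"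
    using cont t r(2) unfolding continuous_on_iff by (metis atLeast_iff diff_gt_0_iff_gt)
  obtain a where a: "a \<in> \<rat>" "t - d < a" "a < t" using Rats_dense_in_real[of "t - d" t] d by auto
  obtain b where b: "b \<in> \<rat>" "t < b" "b < t + d" using Rats_dense_in_real[of t "t + d"] d by auto
  have "\<gamma> q \<in> cball c r" if "q \<in> dyadic_times" "a < q" "q < b" for q
  proof -
    have "dist (\<gamma> q) (\<gamma> t) < r - e/4"
      using d(2)[of q] dyadic_times_pos[OF that(1)] that a b by (auto simp: dist_real_def abs_if)
    then show ?thesis using c(2) dist_triangle[of "\<gamma> q" c "\<gamma> t"] by (auto simp: dist_commute)
  qed
  then have "\<gamma> \<in> dyadic_box a b c r" using \<gamma> by (auto simp: dyadic_box_def)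
  then show thesis using that a b c r sub by blast
qed

lemma dyadic_box_in_sigma_sets:
  "dyadic_box a b (c :: real^'n) r \<in> sigma_sets P0 dyadic_cylinders"
proof -
  let ?M = "sigma P0 (dyadic_cylinders :: (real \<Rightarrow> real^'n) set set)"
  have sub: "dyadic_cylinders \<subseteq> Pow (P0 :: (real \<Rightarrow> real^'n) set)"
    by (rule dyadic_cylinders_subset)
  have sp: "space ?M = P0" and st: "sets ?M = sigma_sets P0 dyadic_cylinders"
    using sub by (auto simp: space_measure_of sets_measure_of)
  have ev: "{\<gamma>\<in>space ?M. a < q \<and> q < b \<longrightarrow> \<gamma> q \<in> cball c r} \<in> sets ?M" if "q \<in> dyadic_times" for q
  proof -
    obtain n j where q: "q = real (Suc j) / 2^n" "j < 4^n" using \<open>q \<in> dyadic_times\<close> by (auto simp: dyadic_times_def)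
    let ?B = "{y \<in> space (sample_space n). y j \<in> cball c r}"
    have B: "?B \<in> sets (sample_space n)"
    proof -
      have "(\<lambda>y. y j) \<in> sample_space n \<rightarrow>\<^sub>M lborel"
        by (rule measurable_component_singleton) (use q in auto)
      from measurable_sets[OF this, of "cball c r"] show ?thesis
        by (simp add: vimage_def Int_def conj_commute)
    qed
    have "{\<gamma>\<in>P0. \<gamma> q \<in> cball c r} = dyadic_sample n -` ?B \<inter> P0"
      using dyadic_sample_in_space[of n UNIV] q by (auto simp: dyadic_sample_def simp del: of_nat_Suc)
    then have "{\<gamma>\<in>P0. \<gamma> q \<in> cball c r} \<in> dyadic_cylinders"
      using B unfolding dyadic_cylinders_def sets_dyadic_sample by blast
    then have "{\<gamma>\<in>space ?M. \<gamma> q \<in> cball c r} \<in> sets ?M" unfolding sp st by (rule sigma_sets.Basic)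
    then show ?thesis by (cases "a < q \<and> q < b") auto
  qed
  have "{\<gamma>\<in>space ?M. \<forall>q\<in>dyadic_times. a < q \<and> q < b \<longrightarrow> \<gamma> q \<in> cball c r} \<in> sets ?M"
    by (rule sets.sets_Collect_countable_All'[OF ev countable_dyadic_times])
  then show ?thesis by (simp only: sp st dyadic_box_def)
qed

text \<open>By induction on the generation of the topology, every path in \<open>S\<close> lies in a
  member of the countable family \<open>\<I>\<close> contained in \<open>S\<close>; thus
  \<open>S\<close> is a countable union of measurable sets.\<close>

lemma openin_compact_open_in_sigma_sets:
  fixes S :: "(real \<Rightarrow> real^'n) set"
  assumes S: "openin compact_open_P0 S"
  shows "S \<in> sigma_sets P0 dyadic_cylinders"
proof -
  obtain D :: "(real^'n) set" where D: "countable D" "\<And>X. open X \<Longrightarrow> X \<noteq> {} \<Longrightarrow> \<exists>d\<in>D. d \<in> X"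
    using countable_dense_exists by blast
  define \<G> where "\<G> = (\<lambda>(a, b, c, r). dyadic_box a b c r) ` (\<rat> \<times> \<rat> \<times> D \<times> \<rat>)"
  have cG: "countable \<G>" unfolding \<G>_def using D(1) countable_rat by (intro countable_image countable_SIGMA) auto
  \<comment> \<open>Intersecting with \<open>P0\<close> gives the empty family the value
    \<open>P0\<close> instead of all functions.\<close>
  define \<I> where "\<I> = (\<lambda>F. P0 \<inter> \<Inter>F) ` {F. finite F \<and> F \<subseteq> \<G>}"
  have cI: "countable \<I>" unfolding \<I>_def by (intro countable_image countable_Collect_finite_subset cG)
  have sub: "dyadic_cylinders \<subseteq> Pow (P0 :: (real \<Rightarrow> real^'n) set)"
    by (rule dyadic_cylinders_subset)
  interpret sigma_algebra P0 "sigma_sets P0 (dyadic_cylinders :: (real \<Rightarrow> real^'n) set set)"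
    by (rule sigma_algebra_sigma_sets[OF sub])
  have IM: "I \<in> sigma_sets P0 dyadic_cylinders" if I: "I \<in> \<I>" for I
  proof -
    obtain F where F: "finite F" "F \<subseteq> \<G>" "I = P0 \<inter> \<Inter>F" using I unfolding \<I>_def by blast
    have "F \<subseteq> sigma_sets P0 dyadic_cylinders" using F(2) by (auto simp: \<G>_def intro!: dyadic_box_in_sigma_sets)
    with F(1) have "P0 \<inter> \<Inter>F \<in> sigma_sets P0 dyadic_cylinders"
    proof (induction F rule: finite_induct)
      case (insert x F)
      have "P0 \<inter> \<Inter>(insert x F) = x \<inter> (P0 \<inter> \<Inter>F)" by auto
      then show ?case using insert by auto
    qed auto
    then show ?thesis using F by simp
  qed
  have "generate_topology_on {{\<gamma> \<in> P0. \<gamma> ` K \<subseteq> U} | K U. compact K \<and> K \<subseteq> {0..} \<and> open U} S"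
    using S unfolding compact_open_P0_def openin_topology_generated_by_iff .
  then have base: "\<forall>\<gamma>\<in>S. \<exists>I\<in>\<I>. \<gamma> \<in> I \<and> I \<subseteq> S"
  proof (induction rule: generate_topology_on.induct)
    case (Int a b)
    show ?case
    proof
      fix \<gamma> assume \<gamma>: "\<gamma> \<in> a \<inter> b"
      obtain I J where I: "I \<in> \<I>" "\<gamma> \<in> I" "I \<subseteq> a" and J: "J \<in> \<I>" "\<gamma> \<in> J" "J \<subseteq> b" using Int.IH \<gamma> by blast
      obtain F F' where "finite F" "F \<subseteq> \<G>" "I = P0 \<inter> \<Inter>F" "finite F'" "F' \<subseteq> \<G>" "J = P0 \<inter> \<Inter>F'"
        using I J by (auto simp: \<I>_def)
      then have "I \<inter> J = P0 \<inter> \<Inter>(F \<union> F')" "finite (F \<union> F')" "F \<union> F' \<subseteq> \<G>" by auto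
      then have "I \<inter> J \<in> \<I>" unfolding \<I>_def by blast
      then show "\<exists>I\<in>\<I>. \<gamma> \<in> I \<and> I \<subseteq> a \<inter> b"
        using I(2,3) J(2,3) by (intro bexI[of _ "I \<inter> J"]) auto
    qed
  next
    case (UN K)
    then show ?case by (meson Union_iff Union_upper order_trans)
  next
    case (Basis s)
    then obtain K U where K: "compact K" "K \<subseteq> {0..}" and U: "open U" and s: "s = {\<gamma> \<in> P0. \<gamma> ` K \<subseteq> U}"
      by blast
    show ?case
    proof
      fix \<gamma> assume "\<gamma> \<in> s"
      then have \<gamma>: "\<gamma> \<in> P0" "\<gamma> ` K \<subseteq> U" by (auto simp: s)
      have "\<exists>a b c r. a \<in> \<rat> \<and> b \<in> \<rat> \<and> c \<in> D \<and> r \<in> \<rat> \<and> a < t \<and> t < b \<and> \<gamma> \<in> dyadic_box a b c r \<and> cball c r \<subseteq> U"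
        if t: "t \<in> K" for t
      proof -
        have "0 \<le> t" "\<gamma> t \<in> U" using t K \<gamma> by auto
        then show ?thesis using ex_dyadic_box[OF \<gamma>(1) _ U _ D(2)] by metis
      qed
      then obtain a b c r where abcr: "\<And>t. t \<in> K \<Longrightarrow> a t \<in> \<rat> \<and> b t \<in> \<rat> \<and> c t \<in> D \<and> r t \<in> \<rat> \<and> a t < t \<and> t < b t
           \<and> \<gamma> \<in> dyadic_box (a t) (b t) (c t) (r t) \<and> cball (c t) (r t) \<subseteq> U"
        by metis
      \<comment> \<open>Compactness of \<open>K\<close> leaves finitely many windows; the boxes over
        them confine a path to \<open>U\<close> on all of \<open>K\<close>.\<close>
      have "K \<subseteq> (\<Union>t\<in>K. {a t<..<b t})" using abcr by auto
      then obtain K0 where K0: "K0 \<subseteq> K" "finite K0" "K \<subseteq> (\<Union>t\<in>K0. {a t<..<b t})"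
        using compactE_image[OF K(1), of K "\<lambda>t. {a t<..<b t}"] by auto
      define F where "F = (\<lambda>t. dyadic_box (a t) (b t) (c t) (r t)) ` K0"
      have F: "finite F" "F \<subseteq> \<G>" using K0 abcr by (auto simp: F_def \<G>_def image_iff Bex_def)
      have "P0 \<inter> \<Inter>F \<in> \<I>" using F unfolding \<I>_def by blast
      moreover have "\<gamma> \<in> P0 \<inter> \<Inter>F" using \<gamma> abcr K0 by (auto simp: F_def)
      moreover have "P0 \<inter> \<Inter>F \<subseteq> s"
      proof
        fix \<eta> assume \<eta>: "\<eta> \<in> P0 \<inter> \<Inter>F"
        have "\<eta> t \<in> U" if t: "t \<in> K" for t
        proof -
          obtain u where u: "u \<in> K0" "a u < t" "t < b u" using K0 t by auto
          have "\<eta> \<in> dyadic_box (a u) (b u) (c u) (r u)" using \<eta> u by (auto simp: F_def)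
          then have "\<eta> t \<in> cball (c u) (r u)" using u t K by (intro dyadic_box_imp_cball) auto
          then show ?thesis using abcr[of u] u K0 by blast
        qed
        then show "\<eta> \<in> s" using \<eta> by (auto simp: s)
      qed
      ultimately show "\<exists>I\<in>\<I>. \<gamma> \<in> I \<and> I \<subseteq> s" by blast
    qed
  qed auto
  have "S = \<Union>{I\<in>\<I>. I \<subseteq> S}" using base by blast
  moreover have "\<Union>{I\<in>\<I>. I \<subseteq> S} \<in> sigma_sets P0 dyadic_cylinders"
    using cI IM by (intro countable_Union) (auto intro: countable_subset[of _ \<I>])
  ultimately show ?thesis by simp
qed

lemma sets_borel_P0_eq_dyadic_cylinders:
  "sets borel_P0 = sigma_sets P0 (dyadic_cylinders :: (real \<Rightarrow> real^'n) set set)"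
proof (rule equalityI)
  show "sets borel_P0 \<subseteq> sigma_sets P0 (dyadic_cylinders :: (real \<Rightarrow> real^'n) set set)"
    unfolding sets_borel_P0 by (rule sigma_sets_mono) (auto intro: openin_compact_open_in_sigma_sets)
  have "S \<in> sets borel_P0" if S: "S \<in> dyadic_cylinders" for S :: "(real \<Rightarrow> real^'n) set"
  proof -
    obtain n B where "B \<in> sets (sample_space n)" "S = dyadic_sample n -` B \<inter> P0"
      using S unfolding dyadic_cylinders_def sets_dyadic_sample by blast
    then show ?thesis using measurable_sets[OF dyadic_sample_measurable_borel_P0, of B n] by simp
  qed
  then show "sigma_sets P0 (dyadic_cylinders :: (real \<Rightarrow> real^'n) set set) \<subseteq> sets borel_P0"
    using sets.sigma_sets_subset[of dyadic_cylinders borel_P0] by auto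
qed

lemma P0_add: "\<gamma> \<in> P0 \<Longrightarrow> h \<in> P0 \<Longrightarrow> (\<lambda>s. \<gamma> s + h s) \<in> P0"
  by (auto simp: P0_def intro: continuous_on_add)

text \<open>It suffices to treat cylinder sets, where adding \<open>h\<close> shifts finitely many
  sampled coordinates by constants.\<close>

lemma translation_measurable:
  fixes h :: "real \<Rightarrow> real^'n"
  assumes h: "h \<in> P0"
  shows "(\<lambda>\<gamma> s. \<gamma> s + h s) \<in> borel_P0 \<rightarrow>\<^sub>M borel_P0"
proof (rule measurable_sigma_sets)
  show "sets borel_P0 = sigma_sets P0 (dyadic_cylinders :: (real \<Rightarrow> real^'n) set set)"
    by (rule sets_borel_P0_eq_dyadic_cylinders)
  show "dyadic_cylinders \<subseteq> Pow (P0 :: (real \<Rightarrow> real^'n) set)"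
    by (rule dyadic_cylinders_subset)
  show "(\<lambda>\<gamma> s. \<gamma> s + h s) \<in> space borel_P0 \<rightarrow> P0" using h by (auto intro: P0_add)
  fix S :: "(real \<Rightarrow> real^'n) set" assume "S \<in> dyadic_cylinders"
  then obtain n B where B: "B \<in> sets (sample_space n)" "S = dyadic_sample n -` B \<inter> P0"
    unfolding dyadic_cylinders_def sets_dyadic_sample by blast
  have "(\<lambda>\<gamma>. \<lambda>i\<in>{..<4^n}. \<gamma> (real (Suc i) / 2^n) + h (real (Suc i) / 2^n)) \<in> borel_P0 \<rightarrow>\<^sub>M sample_space n"
  proof (rule measurable_restrict)
    fix i
    have "(\<lambda>\<gamma>. \<gamma> (real (Suc i) / 2^n) + h (real (Suc i) / 2^n)) \<in> borel_measurable borel_P0"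
      by (intro borel_measurable_add eval_measurable_borel_P0 borel_measurable_const)
    then show "(\<lambda>\<gamma>. \<gamma> (real (Suc i) / 2^n) + h (real (Suc i) / 2^n)) \<in> borel_P0 \<rightarrow>\<^sub>M lborel" by simp
  qed
  then have "(\<lambda>\<gamma>. dyadic_sample n (\<lambda>s. \<gamma> s + h s)) \<in> borel_P0 \<rightarrow>\<^sub>M sample_space n"
    by (simp only: dyadic_sample_def)
  from measurable_sets[OF this B(1)]
  show "(\<lambda>\<gamma> s. \<gamma> s + h s) -` S \<inter> space borel_P0 \<in> sets borel_P0"
    using h by (simp add: B(2) vimage_def Int_def P0_add conj_commute cong: conj_cong)
qed

section \<open>Translates of Wiener measure\<close>

text \<open>The left-hand product is, up to a constant factor, the weighted geometric mean of the two
  products on the right. Bounding it by an arithmetic mean with a free parameter \<open>\<theta>\<close> keeps the estimate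
  linear, so that it extends from densities to measures; optimising \<open>\<theta>\<close> at the end recovers the
  geometric mean.\<close>
lemma gaussian_prod_le:
  fixes w u1 u2 :: "nat \<Rightarrow> 'a::real_inner"
  assumes l: "0 < l1" "0 < l2" "l1 + l2 = 1" and \<delta>: "0 < \<delta>" and c: "0 \<le> c"
    and K: "(\<Sum>i<k. (norm (u1 i - u2 i))\<^sup>2 / \<delta>) \<le> K"
  shows "(\<Prod>i<k. c * exp (- (norm (w i - (l1 *\<^sub>R u1 i + l2 *\<^sub>R u2 i)))\<^sup>2 / (4 * \<delta>)))
    \<le> exp (l1 * l2 * K / 4) * (l1 * exp (l2 * \<theta>)) * (\<Prod>i<k. c * exp (- (norm (w i - u1 i))\<^sup>2 / (4 * \<delta>)))
    + exp (l1 * l2 * K / 4) * (l2 * exp (- l1 * \<theta>)) * (\<Prod>i<k. c * exp (- (norm (w i - u2 i))\<^sup>2 / (4 * \<delta>)))"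
proof -
  have pexp: "(\<Prod>i<k. c * exp (- (norm (w i - u i))\<^sup>2 / (4 * \<delta>))) = c^k * exp (- (\<Sum>i<k. (norm (w i - u i))\<^sup>2 / (4 * \<delta>)))"
    for u :: "nat \<Rightarrow> 'a"
    by (simp add: prod.distrib exp_sum sum_negf[symmetric])
  have l1: "l1 = 1 - l2" using l by simp
  have conv: "exp (l1 * x + l2 * y) \<le> l1 * exp x + l2 * exp y" for x y :: real
    unfolding l1 using convex_onD[OF exp_convex, of l2 x y] l by simp
  define S where "S u = (\<Sum>i<k. (norm (w i - u i))\<^sup>2 / (4 * \<delta>))" for u :: "nat \<Rightarrow> 'a"
  define R where "R = l1 * l2 / 4 * (\<Sum>i<k. (norm (u1 i - u2 i))\<^sup>2 / \<delta>)"
  have R: "R \<le> l1 * l2 * K / 4" unfolding R_def using mult_left_mono[OF K, of "l1 * l2 / 4"] l by simp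
  have pw: "(norm (x - (l1 *\<^sub>R a + l2 *\<^sub>R b)))\<^sup>2 = l1 * (norm (x - a))\<^sup>2 + l2 * (norm (x - b))\<^sup>2 - l1 * l2 * (norm (a - b))\<^sup>2"
    for x a b :: 'a
  proof -
    have l2: "l2 = 1 - l1" using l by simp
    show ?thesis unfolding power2_norm_eq_inner l2
      by (simp add: inner_add_left inner_add_right inner_diff_left inner_diff_right inner_commute algebra_simps power2_eq_square)
  qed
  have "S (\<lambda>i. l1 *\<^sub>R u1 i + l2 *\<^sub>R u2 i) = l1 * S u1 + l2 * S u2 - R"
    unfolding S_def R_def pw sum_distrib_left sum.distrib[symmetric] sum_subtractf[symmetric]
    using \<delta> by (intro sum.cong) (auto simp: field_simps)
  \<comment> \<open>The terms with \<open>\<theta>\<close> cancel, since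
    \<open>l1 * (l2 * \<theta>) + l2 * (- l1 * \<theta>) = 0\<close>; they become weights once
    convexity of the exponential is applied.\<close>
  then have "- S (\<lambda>i. l1 *\<^sub>R u1 i + l2 *\<^sub>R u2 i) = R + (l1 * (l2 * \<theta> - S u1) + l2 * (- l1 * \<theta> - S u2))"
    by (simp add: algebra_simps)
  then have "exp (- S (\<lambda>i. l1 *\<^sub>R u1 i + l2 *\<^sub>R u2 i)) = exp R * exp (l1 * (l2 * \<theta> - S u1) + l2 * (- l1 * \<theta> - S u2))"
    by (simp only: exp_add)
  also have "\<dots> \<le> exp (l1 * l2 * K / 4) * (l1 * exp (l2 * \<theta> - S u1) + l2 * exp (- l1 * \<theta> - S u2))"
  proof (rule mult_mono)
    show "exp (l1 * (l2 * \<theta> - S u1) + l2 * (- l1 * \<theta> - S u2)) \<le> l1 * exp (l2 * \<theta> - S u1) + l2 * exp (- l1 * \<theta> - S u2)"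
      by (rule conv)
  qed (use R in auto)
  finally have "c^k * exp (- S (\<lambda>i. l1 *\<^sub>R u1 i + l2 *\<^sub>R u2 i))
      \<le> c^k * (exp (l1 * l2 * K / 4) * (l1 * exp (l2 * \<theta> - S u1) + l2 * exp (- l1 * \<theta> - S u2)))"
    using c by (intro mult_left_mono) auto
  also have "\<dots> = exp (l1 * l2 * K / 4) * (l1 * exp (l2 * \<theta>)) * (c^k * exp (- S u1))
      + exp (l1 * l2 * K / 4) * (l2 * exp (- l1 * \<theta>)) * (c^k * exp (- S u2))"
  proof -
    have "exp (x - s) = exp x * exp (- s)" for x s :: real by (simp add: exp_diff exp_minus divide_inverse)
    then show ?thesis by (simp only: distrib_left mult_ac)
  qed
  finally show ?thesis unfolding pexp S_def .
qed

definition wiener_density :: "nat \<Rightarrow> (nat \<Rightarrow> real^'n) \<Rightarrow> ennreal" where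
  "wiener_density n y = (\<Prod>i<4^n. ennreal (heat_kernel (1/2^n) (if i = 0 then 0 else y (i - 1)) (y i)))"

lemma wiener_density_measurable:
  "wiener_density n \<in> borel_measurable (sample_space n :: (nat \<Rightarrow> real^'n) measure)"
  unfolding wiener_density_def[abs_def]
proof (rule borel_measurable_prod_ennreal)
  fix i :: nat assume i: "i \<in> {..<4^n}"
  have [measurable]: "(\<lambda>y. y i) \<in> borel_measurable (sample_space n :: (nat \<Rightarrow> real^'n) measure)"
    using measurable_component_singleton[OF i, of "\<lambda>_. lborel :: (real^'n) measure"] by simp
  \<comment> \<open>Natural subtraction truncates, so \<open>i - 1\<close> is a valid index even for
    \<open>i = 0\<close>.\<close>
  have i1: "i - 1 \<in> {..<4^n}" using i by auto
  have m1: "(\<lambda>y. y (i - 1)) \<in> borel_measurable (sample_space n :: (nat \<Rightarrow> real^'n) measure)"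
    using measurable_component_singleton[OF i1, of "\<lambda>_. lborel :: (real^'n) measure"] by simp
  have [measurable]: "(\<lambda>y. if i = 0 then 0 else y (i - 1)) \<in> borel_measurable (sample_space n :: (nat \<Rightarrow> real^'n) measure)"
    using m1 by (cases "i = 0") simp_all
  show "(\<lambda>y. ennreal (heat_kernel (1/2^n) (if i = 0 then 0 else y (i - 1)) (y i)))
      \<in> borel_measurable (sample_space n :: (nat \<Rightarrow> real^'n) measure)"
    unfolding heat_kernel_def by measurable
qed

lemma distr_dyadic_sample:
  fixes P :: "(real \<Rightarrow> real^'n) measure"
  assumes P: "is_wiener_measure P"
  shows "distr P (sample_space n) (dyadic_sample n) = density (sample_space n) (wiener_density n)"
proof -
  define t :: "nat \<Rightarrow> real" where "t i = real (Suc i) / 2^n" for i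
  have "(4::nat)^n > 0 \<and> 0 < t 0 \<and> (\<forall>i. Suc i < 4^n \<longrightarrow> t i < t (Suc i))"
    by (auto simp: t_def divide_strict_right_mono)
  then have "distr P (PiM {..<4^n} (\<lambda>_. lborel)) (\<lambda>\<gamma>. \<lambda>i\<in>{..<4^n}. \<gamma> (t i))
        = density (PiM {..<4^n} (\<lambda>_. (lborel :: (real^'n) measure)))
            (\<lambda>y. \<Prod>i<4^n. ennreal (heat_kernel
                     (if i = 0 then t 0 else t i - t (i - 1))
                     (if i = 0 then 0 else y (i - 1)) (y i)))"
    using P unfolding is_wiener_measure_def by blast
  moreover have "(if i = 0 then t 0 else t i - t (i - 1)) = 1/2^n" for i
    by (cases i) (auto simp: t_def diff_divide_distrib[symmetric])
  ultimately show ?thesis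
    by (simp only: t_def dyadic_sample_def[abs_def] wiener_density_def[abs_def])
qed

text \<open>Adding \<open>h\<close> to a path adds a fixed vector to its sample; translation
  invariance of the product Lebesgue measure moves that vector into the argument of the
  density.\<close>

lemma emeasure_translated_cylinder:
  fixes P :: "(real \<Rightarrow> real^'n) measure"
  assumes P: "is_wiener_measure P" and h: "h \<in> P0" and B: "B \<in> sets (sample_space n)"
  shows "emeasure (distr P borel_P0 (\<lambda>\<gamma> s. \<gamma> s + h s)) (dyadic_sample n -` B \<inter> P0)
     = (\<integral>\<^sup>+z\<in>B. wiener_density n (\<lambda>i. z i - h (real (Suc i) / 2^n)) \<partial>sample_space n)"
proof -
  have [measurable_cong]: "sets P = sets borel_P0" and sp: "space P = P0"
    using P by (auto simp: is_wiener_measure_def)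
  have sh: "(\<lambda>\<gamma> s. \<gamma> s + h s) \<in> P \<rightarrow>\<^sub>M borel_P0" using translation_measurable[OF h] by measurable
  have ds: "dyadic_sample n \<in> P \<rightarrow>\<^sub>M sample_space n" using dyadic_sample_measurable_borel_P0 by measurable
  define v where "v i = h (real (Suc i) / 2^n)" for i
  define \<tau> where "\<tau> = (\<lambda>y::nat \<Rightarrow> real^'n. \<lambda>i\<in>{..<4^n}. y i + v i)"
  define \<rho> where "\<rho> = (\<lambda>y::nat \<Rightarrow> real^'n. \<lambda>i\<in>{..<4^n}. y i - v i)"
  have \<tau>[measurable]: "\<tau> \<in> sample_space n \<rightarrow>\<^sub>M sample_space n"
    unfolding \<tau>_def by (rule measurable_restrict) measurable
  have \<rho>[measurable]: "\<rho> \<in> sample_space n \<rightarrow>\<^sub>M sample_space n"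
    unfolding \<rho>_def by (rule measurable_restrict) measurable
  note [measurable] = wiener_density_measurable B
  have cong: "wiener_density n y = wiener_density n y'" if "\<And>i. i < 4^n \<Longrightarrow> y i = y' i" for y y' :: "nat \<Rightarrow> real^'n"
    unfolding wiener_density_def using that by (intro prod.cong) auto
  have "emeasure (distr P borel_P0 (\<lambda>\<gamma> s. \<gamma> s + h s)) (dyadic_sample n -` B \<inter> P0)
     = emeasure P ((\<lambda>\<gamma> s. \<gamma> s + h s) -` (dyadic_sample n -` B \<inter> P0) \<inter> space P)"
    using measurable_sets[OF dyadic_sample_measurable_borel_P0 B] by (intro emeasure_distr sh) simp
  also have "(\<lambda>\<gamma> s. \<gamma> s + h s) -` (dyadic_sample n -` B \<inter> P0) \<inter> space P
     = dyadic_sample n -` (\<tau> -` B \<inter> space (sample_space n)) \<inter> space P"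
  proof -
    have "dyadic_sample n (\<lambda>s. \<gamma> s + h s) = \<tau> (dyadic_sample n \<gamma>)" for \<gamma>
      by (auto simp: dyadic_sample_def \<tau>_def v_def fun_eq_iff)
    then show ?thesis using dyadic_sample_in_space[of n UNIV] h by (auto simp: sp P0_add)
  qed
  also have "emeasure P \<dots> = emeasure (distr P (sample_space n) (dyadic_sample n)) (\<tau> -` B \<inter> space (sample_space n))"
    using measurable_sets[OF \<tau> B] by (intro emeasure_distr[symmetric] ds)
  also have "\<dots> = (\<integral>\<^sup>+y. wiener_density n y * indicator (\<tau> -` B \<inter> space (sample_space n)) y \<partial>sample_space n)"
    unfolding distr_dyadic_sample[OF P] using measurable_sets[OF \<tau> B]
    by (intro emeasure_density) measurable
  \<comment> \<open>The density is rewritten through the inverse shift \<open>\<rho>\<close> so that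
    the integrand depends on \<open>y\<close> only through \<open>\<tau> y\<close>, ready for the
    change of variables.\<close>
  also have "\<dots> = (\<integral>\<^sup>+y. wiener_density n (\<rho> (\<tau> y)) * indicator B (\<tau> y) \<partial>sample_space n)"
  proof (rule nn_integral_cong)
    fix y :: "nat \<Rightarrow> real^'n" assume "y \<in> space (sample_space n)"
    moreover have "wiener_density n y = wiener_density n (\<rho> (\<tau> y))" by (rule cong) (simp add: \<rho>_def \<tau>_def)
    ultimately show "wiener_density n y * indicator (\<tau> -` B \<inter> space (sample_space n)) y
        = wiener_density n (\<rho> (\<tau> y)) * indicator B (\<tau> y)"
      by (simp add: indicator_def)
  qed
  also have "\<dots> = (\<integral>\<^sup>+z. wiener_density n (\<rho> z) * indicator B z \<partial>distr (sample_space n) (sample_space n) \<tau>)"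
    by (subst nn_integral_distr) measurable
  also have "distr (sample_space n) (sample_space n) \<tau> = sample_space n"
    unfolding \<tau>_def by (rule distr_PiM_lborel_translate) simp
  also have "(\<integral>\<^sup>+z. wiener_density n (\<rho> z) * indicator B z \<partial>sample_space n)
      = (\<integral>\<^sup>+z\<in>B. wiener_density n (\<lambda>i. z i - h (real (Suc i) / 2^n)) \<partial>sample_space n)"
  proof (rule nn_integral_cong)
    fix z :: "nat \<Rightarrow> real^'n"
    have "wiener_density n (\<rho> z) = wiener_density n (\<lambda>i. z i - h (real (Suc i) / 2^n))"
      by (rule cong) (simp add: \<rho>_def v_def)
    then show "wiener_density n (\<rho> z) * indicator B z
        = wiener_density n (\<lambda>i. z i - h (real (Suc i) / 2^n)) * indicator B z" by simp
  qed
  finally show ?thesis .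
qed

text \<open>Rewrites the shifted density in terms of increments, the form that
  \<open>gaussian_prod_le\<close> takes; in the first factor the preceding grid point is time
  \<open>0\<close>, where \<open>h 0 = 0\<close>.\<close>

lemma wiener_density_translate:
  fixes z :: "nat \<Rightarrow> real^'n"
  assumes h: "h \<in> P0"
  shows "wiener_density n (\<lambda>i. z i - h (real (Suc i) / 2^n))
    = ennreal (\<Prod>i<4^n. (4 * pi * (1/2^n)) powr (- real CARD('n) / 2) *
        exp (- (norm (((if i = 0 then 0 else z (i - 1)) - z i) - (h (real i * (1/2^n)) - h (real (Suc i) * (1/2^n)))))\<^sup>2 / (4 * (1/2^n))))"
proof -
  have h0: "h 0 = 0" using h by (simp add: P0_def)
  have "(if i = 0 then 0 else z (i - 1) - h (real (Suc (i - 1)) / 2^n)) - (z i - h (real (Suc i) / 2^n))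
      = ((if i = 0 then 0 else z (i - 1)) - z i) - (h (real i * (1/2^n)) - h (real (Suc i) * (1/2^n)))" for i
    using h0 by (cases i) (auto simp: algebra_simps)
  then show ?thesis
    unfolding wiener_density_def heat_kernel_def by (simp only: prod_ennreal powr_ge_zero mult_nonneg_nonneg exp_ge_zero)
qed

text \<open>The Gaussian estimate with \<open>\<delta> = 1 / 2^n\<close>, integrated over
  \<open>B\<close>. Since \<open>K\<close> bounds the discrete energy on every grid, the constants
  do not depend on \<open>n\<close>, as the passage to the sigma-algebra requires.\<close>

lemma emeasure_translated_cylinder_le:
  fixes P :: "(real \<Rightarrow> real^'n) measure"
  assumes P: "is_wiener_measure P" and h: "h1 \<in> P0" "h2 \<in> P0" and B: "B \<in> sets (sample_space n)"
    and l: "0 < l1" "0 < l2" "l1 + l2 = 1"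
    and K: "\<And>\<delta> k. 0 < \<delta> \<Longrightarrow> (\<Sum>i<k. (norm ((h1 (real (Suc i) * \<delta>) - h2 (real (Suc i) * \<delta>))
        - (h1 (real i * \<delta>) - h2 (real i * \<delta>))))\<^sup>2 / \<delta>) \<le> K"
  defines "h \<equiv> \<lambda>t. l1 *\<^sub>R h1 t + l2 *\<^sub>R h2 t"
  shows "emeasure (distr P borel_P0 (\<lambda>\<gamma> s. \<gamma> s + h s)) (dyadic_sample n -` B \<inter> P0)
     \<le> ennreal (exp (l1 * l2 * K / 4) * (l1 * exp (l2 * \<theta>))) * emeasure (distr P borel_P0 (\<lambda>\<gamma> s. \<gamma> s + h1 s)) (dyadic_sample n -` B \<inter> P0)
     + ennreal (exp (l1 * l2 * K / 4) * (l2 * exp (- l1 * \<theta>))) * emeasure (distr P borel_P0 (\<lambda>\<gamma> s. \<gamma> s + h2 s)) (dyadic_sample n -` B \<inter> P0)"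
proof -
  have hP: "h \<in> P0" using h by (auto simp: h_def P0_def intro!: continuous_intros)
  define D where "D g z = wiener_density n (\<lambda>i. z i - g (real (Suc i) / 2^n))" for g :: "real \<Rightarrow> real^'n" and z
  define c1 where "c1 = exp (l1 * l2 * K / 4) * (l1 * exp (l2 * \<theta>))"
  define c2 where "c2 = exp (l1 * l2 * K / 4) * (l2 * exp (- l1 * \<theta>))"
  have c: "0 \<le> c1" "0 \<le> c2" using l by (auto simp: c1_def c2_def)
  have Dm: "D g \<in> borel_measurable (sample_space n)" for g
  proof -
    have "(\<lambda>z. \<lambda>i\<in>{..<4^n}. z i - g (real (Suc i) / 2^n)) \<in> sample_space n \<rightarrow>\<^sub>M sample_space n"
      by (rule measurable_restrict) measurable
    from measurable_compose[OF this wiener_density_measurable]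
    have "(\<lambda>z. wiener_density n (\<lambda>i\<in>{..<4^n}. z i - g (real (Suc i) / 2^n))) \<in> borel_measurable (sample_space n)" .
    moreover have "wiener_density n (\<lambda>i\<in>{..<4^n}. z i - g (real (Suc i) / 2^n)) = D g z" for z
      unfolding D_def wiener_density_def by (intro prod.cong) auto
    ultimately show ?thesis by simp
  qed
  have le: "D h z \<le> ennreal c1 * D h1 z + ennreal c2 * D h2 z" for z
  proof -
    let ?\<delta> = "1/2^n :: real"
    let ?c = "(4 * pi * ?\<delta>) powr (- real CARD('n) / 2)"
    let ?w = "\<lambda>i. (if i = 0 then 0 else z (i - 1)) - z i"
    let ?u = "\<lambda>g i. g (real i * ?\<delta>) - g (real (Suc i) * ?\<delta>) :: real^'n"
    let ?p = "\<lambda>g. \<Prod>i<4^n. ?c * exp (- (norm (?w i - ?u g i))\<^sup>2 / (4 * ?\<delta>))"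
    have p0: "0 \<le> ?p g" for g by (intro prod_nonneg) auto
    have Dp: "D g z = ennreal (?p g)" if "g \<in> P0" for g
      unfolding D_def by (rule wiener_density_translate[OF that])
    have u: "?u h i = l1 *\<^sub>R ?u h1 i + l2 *\<^sub>R ?u h2 i" for i by (simp add: h_def algebra_simps)
    have nu: "norm (?u h1 i - ?u h2 i) = norm ((h1 (real (Suc i) * ?\<delta>) - h2 (real (Suc i) * ?\<delta>)) - (h1 (real i * ?\<delta>) - h2 (real i * ?\<delta>)))" for i
      by (subst norm_minus_cancel[symmetric]) (simp add: algebra_simps)
    have "(\<Prod>i<4^n. ?c * exp (- (norm (?w i - (l1 *\<^sub>R ?u h1 i + l2 *\<^sub>R ?u h2 i)))\<^sup>2 / (4 * ?\<delta>))) \<le> c1 * ?p h1 + c2 * ?p h2"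
      unfolding c1_def c2_def
    proof (rule gaussian_prod_le)
      show "(\<Sum>i<4^n. (norm (?u h1 i - ?u h2 i))\<^sup>2 / ?\<delta>) \<le> K"
        unfolding nu by (rule K) simp
    qed (use l in auto)
    then have "?p h \<le> c1 * ?p h1 + c2 * ?p h2" unfolding u .
    then have "ennreal (?p h) \<le> ennreal (c1 * ?p h1 + c2 * ?p h2)" by (rule ennreal_leI)
    also have "\<dots> = ennreal c1 * ennreal (?p h1) + ennreal c2 * ennreal (?p h2)"
      using c p0 by (simp only: ennreal_plus ennreal_mult mult_nonneg_nonneg)
    finally show ?thesis unfolding Dp[OF hP] Dp[OF h(1)] Dp[OF h(2)] .
  qed
  have E: "emeasure (distr P borel_P0 (\<lambda>\<gamma> s. \<gamma> s + g s)) (dyadic_sample n -` B \<inter> P0) = (\<integral>\<^sup>+z\<in>B. D g z \<partial>sample_space n)"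
    if "g \<in> P0" for g
    unfolding D_def by (rule emeasure_translated_cylinder[OF P that B])
  have "(\<integral>\<^sup>+z\<in>B. D h z \<partial>sample_space n)
      \<le> (\<integral>\<^sup>+z. ennreal c1 * (D h1 z * indicator B z) + ennreal c2 * (D h2 z * indicator B z) \<partial>sample_space n)"
    using le by (intro nn_integral_mono) (auto simp: indicator_def)
  also have "\<dots> = ennreal c1 * (\<integral>\<^sup>+z\<in>B. D h1 z \<partial>sample_space n) + ennreal c2 * (\<integral>\<^sup>+z\<in>B. D h2 z \<partial>sample_space n)"
    using Dm B by (subst nn_integral_add) (auto simp: nn_integral_cmult)
  finally show ?thesis unfolding E[OF hP] E[OF h(1)] E[OF h(2)] c1_def c2_def .
qed

text \<open>The comparison of the translated laws passes from cylinder sets to Borel sets, then to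
  integrals. \<open>\<theta>\<close> stays arbitrary because its best value depends on
  \<open>F\<close>.\<close>

lemma translated_nn_integral_le:
  fixes P :: "(real \<Rightarrow> real^'n) measure"
  assumes P: "is_wiener_measure P" and h: "h1 \<in> P0" "h2 \<in> P0"
    and l: "0 < l1" "0 < l2" "l1 + l2 = 1"
    and K: "\<And>\<delta> k. 0 < \<delta> \<Longrightarrow> (\<Sum>i<k. (norm ((h1 (real (Suc i) * \<delta>) - h2 (real (Suc i) * \<delta>))
        - (h1 (real i * \<delta>) - h2 (real i * \<delta>))))\<^sup>2 / \<delta>) \<le> K"
    and F: "F \<in> borel_measurable P"
  shows "(\<integral>\<^sup>+\<gamma>. F (\<lambda>s. \<gamma> s + (l1 *\<^sub>R h1 s + l2 *\<^sub>R h2 s)) \<partial>P)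
     \<le> ennreal (exp (l1 * l2 * K / 4) * (l1 * exp (l2 * \<theta>))) * (\<integral>\<^sup>+\<gamma>. F (\<lambda>s. \<gamma> s + h1 s) \<partial>P)
     + ennreal (exp (l1 * l2 * K / 4) * (l2 * exp (- l1 * \<theta>))) * (\<integral>\<^sup>+\<gamma>. F (\<lambda>s. \<gamma> s + h2 s) \<partial>P)"
proof -
  define h where "h = (\<lambda>t. l1 *\<^sub>R h1 t + l2 *\<^sub>R h2 t)"
  have hP: "h \<in> P0" using h by (auto simp: h_def P0_def intro!: continuous_intros)
  define c1 where "c1 = exp (l1 * l2 * K / 4) * (l1 * exp (l2 * \<theta>))"
  define c2 where "c2 = exp (l1 * l2 * K / 4) * (l2 * exp (- l1 * \<theta>))"
  have c: "0 \<le> c1" "0 \<le> c2" using l by (auto simp: c1_def c2_def)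
  define \<mu> where "\<mu> g = distr P borel_P0 (\<lambda>\<gamma> s. \<gamma> s + g s)" for g :: "real \<Rightarrow> real^'n"
  have sP[measurable_cong]: "sets P = sets borel_P0" and sp: "space P = P0" and pP: "prob_space P"
    using P by (auto simp: is_wiener_measure_def)
  have sh: "(\<lambda>\<gamma> s. \<gamma> s + g s) \<in> P \<rightarrow>\<^sub>M borel_P0" if "g \<in> P0" for g
    using translation_measurable[OF that] by measurable
  have fin: "finite_measure (\<mu> g)" if "g \<in> P0" for g
    unfolding \<mu>_def using prob_space.prob_space_distr[OF pP sh[OF that]] by (rule prob_space.finite_measure)
  have s\<mu>: "sets (\<mu> g) = sets borel_P0" for g by (simp add: \<mu>_def)
  have em: "emeasure (\<mu> g) X = ennreal (measure (\<mu> g) X)" if "g \<in> P0" for g X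
    by (rule finite_measure.emeasure_eq_measure[OF fin[OF that]])
  have le: "measure (\<mu> h) X \<le> c1 * measure (\<mu> h1) X + c2 * measure (\<mu> h2) X" if X: "X \<in> sets (\<mu> h)" for X
  proof (rule measure_le_linear_combination_from_algebra[OF algebra_dyadic_cylinders c _ _ _ _ _ _ _ X])
    fix a :: "(real \<Rightarrow> real^'n) set" assume "a \<in> dyadic_cylinders"
    then obtain n B where B: "B \<in> sets (sample_space n)" and a: "a = dyadic_sample n -` B \<inter> P0"
      unfolding dyadic_cylinders_def sets_dyadic_sample by blast
    have "emeasure (\<mu> h) a \<le> ennreal c1 * emeasure (\<mu> h1) a + ennreal c2 * emeasure (\<mu> h2) a"
      unfolding a \<mu>_def h_def c1_def c2_def by (rule emeasure_translated_cylinder_le[OF P h B l K])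
    then show "measure (\<mu> h) a \<le> c1 * measure (\<mu> h1) a + c2 * measure (\<mu> h2) a"
      using c by (simp add: em hP h ennreal_mult[symmetric] ennreal_plus[symmetric] del: ennreal_plus)
  qed (use fin hP h in \<open>auto simp: s\<mu> sets_borel_P0_eq_dyadic_cylinders\<close>)
  have Fb: "F \<in> borel_measurable borel_P0" using F by (simp add: measurable_cong_sets[OF sP refl])
  have "(\<integral>\<^sup>+\<gamma>. F \<gamma> \<partial>\<mu> h) \<le> ennreal c1 * (\<integral>\<^sup>+\<gamma>. F \<gamma> \<partial>\<mu> h1) + ennreal c2 * (\<integral>\<^sup>+\<gamma>. F \<gamma> \<partial>\<mu> h2)"
  proof (rule nn_integral_le_linear_combination)
    fix X assume "X \<in> sets (\<mu> h)"
    from le[OF this] show "emeasure (\<mu> h) X \<le> ennreal c1 * emeasure (\<mu> h1) X + ennreal c2 * emeasure (\<mu> h2) X"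
      using c by (simp add: em hP h ennreal_mult[symmetric] ennreal_plus[symmetric] del: ennreal_plus)
  qed (use Fb in \<open>auto simp: s\<mu> measurable_cong_sets[OF s\<mu> refl]\<close>)
  moreover have "(\<integral>\<^sup>+\<gamma>. F \<gamma> \<partial>\<mu> g) = (\<integral>\<^sup>+\<gamma>. F (\<lambda>s. \<gamma> s + g s) \<partial>P)" if "g \<in> P0" for g
    unfolding \<mu>_def by (rule nn_integral_distr[OF sh[OF that]]) (simp add: Fb)
  ultimately show ?thesis using hP h by (simp add: c1_def c2_def h_def)
qed

section \<open>Convexity of the functional\<close>

theorem mainTheorem1:
  fixes P :: "(real \<Rightarrow> real^'n) measure"
    and F :: "(real \<Rightarrow> real^'n) \<Rightarrow> real"
    and h1 h2 :: "real \<Rightarrow> real^'n"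
    and l1 l2 :: real
  assumes "is_wiener_measure P"
    and "integrable P F"
    and "\<forall>\<gamma>\<in>space P. F \<gamma> > 0"
    and "h1 \<in> CM" and "h2 \<in> CM"
    and "0 < l1" and "l1 < 1" and "0 < l2" and "l2 < 1" and "l1 + l2 = 1"
  shows "Phi P F (\<lambda>t. l1 *\<^sub>R h1 t + l2 *\<^sub>R h2 t)
           \<le> ereal l1 * Phi P F h1 + ereal l2 * Phi P F h2"
proof -
  let ?h = "\<lambda>t. l1 *\<^sub>R h1 t + l2 *\<^sub>R h2 t"
  define I where "I g = (\<integral>\<^sup>+ \<gamma>. ennreal (F (\<lambda>s. \<gamma> s + g s)) \<partial>P)" for g
  have PhiI: "Phi P F g = (if I g = \<infinity> then \<infinity> else ereal (ln (enn2real (I g)) + CM_norm_sq g / 4))" for g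
    by (simp add: Phi_def I_def Let_def)
  show ?thesis
  proof (cases "I h1 = \<infinity> \<or> I h2 = \<infinity>")
    case True
    \<comment> \<open>Both weights are positive and \<open>Phi\<close> never equals
      \<open>-\<infinity>\<close>, so one infinite term makes the sum infinite.\<close>
    then have eq: "ereal l1 * Phi P F h1 + ereal l2 * Phi P F h2 = \<infinity>"
      using assms by (auto simp: PhiI)
    show ?thesis by (subst eq) simp
  next
    case False
    have hP0: "h1 \<in> P0" "h2 \<in> P0" using assms by (auto simp: CM_def)
    have hP: "?h \<in> P0" using hP0 by (auto simp: P0_def intro!: continuous_intros)
    have sP: "sets P = sets borel_P0" and sp: "space P = P0" and pP: "prob_space P"
      using assms(1) by (auto simp: is_wiener_measure_def)
    have Fm: "F \<in> borel_measurable P" using assms(2) by (rule borel_measurable_integrable)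
    \<comment> \<open>Positivity of \<open>F\<close> keeps the integrals away from \<open>0\<close>,
      so that the logarithms have their usual meaning.\<close>
    have pos: "I g \<noteq> 0" if g: "g \<in> P0" for g
    proof
      assume "I g = 0"
      have sh: "(\<lambda>\<gamma> s. \<gamma> s + g s) \<in> P \<rightarrow>\<^sub>M P"
        using translation_measurable[OF g] by (simp add: measurable_cong_sets[OF sP sP])
      have "(\<lambda>\<gamma>. ennreal (F (\<lambda>s. \<gamma> s + g s))) \<in> borel_measurable P"
        using measurable_compose[OF sh Fm] by simp
      then have "AE \<gamma> in P. ennreal (F (\<lambda>s. \<gamma> s + g s)) = 0"
        using \<open>I g = 0\<close> by (simp add: I_def nn_integral_0_iff_AE)
      moreover have "AE \<gamma> in P. F (\<lambda>s. \<gamma> s + g s) > 0"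
        using assms(3) P0_add[OF _ g] by (intro AE_I2) (auto simp: sp)
      ultimately have "AE \<gamma> in P. False" by eventually_elim (simp add: ennreal_eq_0_iff)
      then show False using prob_space.AE_False[OF pP] by simp
    qed
    obtain K where K: "CM_norm_sq ?h + l1 * l2 * K = l1 * CM_norm_sq h1 + l2 * CM_norm_sq h2"
      "\<And>\<delta> k. 0 < \<delta> \<Longrightarrow> (\<Sum>i<k. (norm ((h1 (real (Suc i) * \<delta>) - h2 (real (Suc i) * \<delta>))
        - (h1 (real i * \<delta>) - h2 (real i * \<delta>))))\<^sup>2 / \<delta>) \<le> K"
      using CM_convex_combination[OF assms(4,5,6,8,10)] by blast
    obtain a1 where a1: "I h1 = ennreal a1" "0 < a1"
      using False pos[OF hP0(1)] by (cases "I h1") (auto simp: less_le)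
    obtain a2 where a2: "I h2 = ennreal a2" "0 < a2"
      using False pos[OF hP0(2)] by (cases "I h2") (auto simp: less_le)
    \<comment> \<open>The minimiser of the bound: with this value both
      \<open>exp (l2 * \<theta>) * a1\<close> and \<open>exp (- l1 * \<theta>) * a2\<close> equal
      the weighted geometric mean \<open>exp L\<close>.\<close>
    define \<theta> where "\<theta> = ln a2 - ln a1"
    define L where "L = l1 * ln a1 + l2 * ln a2"
    have l1: "l1 = 1 - l2" using assms by simp
    have e1: "exp (l2 * \<theta>) * a1 = exp L"
    proof -
      have "exp (l2 * \<theta>) * a1 = exp (l2 * \<theta>) * exp (ln a1)" using a1 by simp
      also have "\<dots> = exp (l2 * \<theta> + ln a1)" by (simp only: exp_add)
      also have "l2 * \<theta> + ln a1 = L" unfolding \<theta>_def L_def l1 by (simp add: algebra_simps)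
      finally show ?thesis .
    qed
    have e2: "exp (- l1 * \<theta>) * a2 = exp L"
    proof -
      have "exp (- l1 * \<theta>) * a2 = exp (- l1 * \<theta>) * exp (ln a2)" using a2 by simp
      also have "\<dots> = exp (- l1 * \<theta> + ln a2)" by (simp only: exp_add)
      also have "- l1 * \<theta> + ln a2 = L" unfolding \<theta>_def L_def l1 by (simp add: algebra_simps)
      finally show ?thesis .
    qed
    let ?C = "exp (l1 * l2 * K / 4)"
    have "I ?h \<le> ennreal (?C * (l1 * exp (l2 * \<theta>))) * I h1 + ennreal (?C * (l2 * exp (- l1 * \<theta>))) * I h2"
      unfolding I_def
      by (rule translated_nn_integral_le[where F="\<lambda>\<gamma>. ennreal (F \<gamma>)", OF assms(1) hP0 assms(6,8,10) K(2)])
        (assumption, rule measurable_compose[OF Fm measurable_ennreal])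
    also have "\<dots> = ennreal (?C * (l1 * exp (l2 * \<theta>)) * a1 + ?C * (l2 * exp (- l1 * \<theta>)) * a2)"
      using a1 a2 assms(6,8) by (simp add: ennreal_mult ennreal_plus)
    also have "?C * (l1 * exp (l2 * \<theta>)) * a1 + ?C * (l2 * exp (- l1 * \<theta>)) * a2
        = ?C * (l1 * (exp (l2 * \<theta>) * a1) + l2 * (exp (- l1 * \<theta>) * a2))"
      by (simp only: algebra_simps)
    also have "\<dots> = exp (l1 * l2 * K / 4 + L)"
      unfolding e1 e2 using assms(10) by (simp add: distrib_right[symmetric] exp_add)
    finally have le: "I ?h \<le> ennreal (exp (l1 * l2 * K / 4 + L))" .
    \<comment> \<open>The combination has a finite integral because both \<open>I h1\<close> and
      \<open>I h2\<close> are finite, so its \<open>Phi\<close> is given by the real-valued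
      branch.\<close>
    then have "I ?h \<noteq> \<infinity>" by (auto simp: top_unique)
    then obtain a where a: "I ?h = ennreal a" "0 < a"
      using pos[OF hP] by (cases "I ?h") (auto simp: less_le)
    have "a \<le> exp (l1 * l2 * K / 4 + L)" using le a by (simp add: ennreal_le_iff)
    then have "ln a \<le> ln (exp (l1 * l2 * K / 4 + L))" using a by (subst ln_le_cancel_iff) auto
    \<comment> \<open>By the energy identity, \<open>l1 * l2 * K / 4\<close> is a quarter of the
      amount by which the averaged energies exceed the energy of the combination.\<close>
    then have "ln a + CM_norm_sq ?h / 4 \<le> l1 * (ln a1 + CM_norm_sq h1 / 4) + l2 * (ln a2 + CM_norm_sq h2 / 4)"
      using K(1) by (simp add: L_def algebra_simps)
    then show ?thesis using a a1 a2 by (simp add: PhiI)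
  qed
qed

end
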